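(* Let $\mathcal M$ be a lazy, aperiodic, ergodic, reversible Markov chain on a finite state space $K$ with $|K|\ge2$, with stationary distribution $\pi$, $\pi_0=\min_{v\in K}\pi(v)$, and spectral gap $\lambda$. Then for every $\epsilon\in(0,1/2]$, $$\frac{1-4\psi_{big}(1/2)}{8\,\psi_{big}(1/2)}\,\log\frac{1}{2\epsilon}\ \le\ \tau(\epsilon)\ \le\ \frac{2}{\psi^+(1/2)}\Bigl(\log(1/\pi_0)+2\log\frac{1}{2\epsilon}\Bigr),$$ and $$4\,\psi_{big}(1/2)\ \ge\ \lambda\ \ge\ \tfrac14\,\psi^+(1/2).$$
   Context: $P$ is the transition matrix on the finite set $K$; lazy means $P(v,v)\ge1/2$ for all $v$; ergodic means irreducible and aperiodic; reversible means $\pi(i)P(i,j)=\pi(j)P(j,i)$. The spectral gap is $\lambda=1-\lambda_2$, where $\lambda_2$ is the second largest eigenvalue of $P$. Logarithms are natural. Ergodic flow: $q(i,j)=\pi(i)P(i,j)$. Continuization: $\tilde K=[0,1]$ is partitioned (up to null sets) into intervals $I_v$, $v\in K$, of length $\pi(v)$. For measurable $A,B\subset\tilde K$ let $\pi(A)=m(A)$ ($m$ is Lebesgue measure) and $$Q(A,B)=\sum_{x,y\in K}\frac{m(A\cap I_x)}{\pi(x)}\frac{m(B\cap I_y)}{\pi(y)}\,q(x,y).$$ A set $A\subset K$ is identified with $\bigcup_{v\in A}I_v\subset\tilde K$; $A^c$ is the complement. For $A\subset K$ and $0\le t\le\pi(A)$ let $$\Psi(t,A^c)=\inf_{B}Q(B,A^c),\qquad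 \Psi_{big}(t,A^c)=\sup_{B}Q(B,A^c),$$ where $B$ ranges over measurable $B\subset\tilde K$ with $B\subset A$, $\pi(B)=t$. For nonempty $A\subset K$, $$\psi^+(A)=\int_0^{\pi(A)}\frac{\Psi(t,A^c)}{\pi(A)^2}\,dt,\qquad \psi_{big}(A)=\int_0^{\pi(A)}\frac{\Psi_{big}(t,A^c)}{\pi(A)^2}\,dt,$$ and $$\psi^+(x)=\inf_{\emptyset\ne A\subset K,\ \pi(A)\le x}\psi^+(A),\qquad \psi_{big}(x)=\inf_{\emptyset\ne A\subset K,\ \pi(A)\le x}\psi_{big}(A).$$ Mixing time: $\|p-\pi\|_{TV}=\frac12\sum_v|p(v)-\pi(v)|$, and $\tau(\epsilon)=\max_{p^{(0)}}\min\{t:\|p^{(0)}P^t-\pi\|_{TV}\le\epsilon\}$, the maximum being over initial distributions $p^{(0)}$ on $K$. *)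

theory Defs
  imports "HOL-Analysis.Analysis" "HOL-Library.Multiset"
begin

text \<open>
  The finite state space \<open>K\<close> is the index type \<^typ>\<open>'k::finite\<close>.  Distributions are row vectors and
  transition matrices act on them from the right.
\<close>

definition prob_vec :: "real ^ 'k::finite \<Rightarrow> bool" where
  "prob_vec p \<longleftrightarrow> (\<forall>v. 0 \<le> p $ v) \<and> (\<Sum>v\<in>UNIV. p $ v) = 1"

definition transition_matrix :: "real ^ 'k::finite ^ 'k \<Rightarrow> bool" where
  "transition_matrix P \<longleftrightarrow> (\<forall>i. prob_vec (P $ i))"

text \<open>The operation \<open>^\<close> on \<^typ>\<open>real ^ 'k ^ 'k\<close> is componentwise, hence a separate matrix power.\<close>

definition mat_power :: "real ^ 'k::finite ^ 'k \<Rightarrow> nat \<Rightarrow> real ^ 'k ^ 'k" where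
  "mat_power P t = (((**) P) ^^ t) (mat 1)"

definition lazy_chain :: "real ^ 'k::finite ^ 'k \<Rightarrow> bool" where
  "lazy_chain P \<longleftrightarrow> (\<forall>v. 1 / 2 \<le> P $ v $ v)"

definition irreducible_chain :: "real ^ 'k::finite ^ 'k \<Rightarrow> bool" where
  "irreducible_chain P \<longleftrightarrow> (\<forall>i j. \<exists>t. 0 < mat_power P t $ i $ j)"

definition aperiodic_chain :: "real ^ 'k::finite ^ 'k \<Rightarrow> bool" where
  "aperiodic_chain P \<longleftrightarrow> (\<forall>i. Gcd {t. 1 \<le> t \<and> 0 < mat_power P t $ i $ i} = 1)"

definition ergodic_chain :: "real ^ 'k::finite ^ 'k \<Rightarrow> bool" where
  "ergodic_chain P \<longleftrightarrow> irreducible_chain P \<and> aperiodic_chain P"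

definition stationary_dist :: "real ^ 'k::finite ^ 'k \<Rightarrow> real ^ 'k \<Rightarrow> bool" where
  "stationary_dist P \<pi> \<longleftrightarrow> prob_vec \<pi> \<and> \<pi> v* P = \<pi>"

definition reversible_chain :: "real ^ 'k::finite ^ 'k \<Rightarrow> real ^ 'k \<Rightarrow> bool" where
  "reversible_chain P \<pi> \<longleftrightarrow> (\<forall>i j. \<pi> $ i * P $ i $ j = \<pi> $ j * P $ j $ i)"

definition eigenspace :: "real ^ 'k::finite ^ 'k \<Rightarrow> real \<Rightarrow> (real ^ 'k) set" where
  "eigenspace P \<mu> = {f. P *v f = \<mu> *\<^sub>R f}"

text \<open>
  Eigenvalues are listed in decreasing order and repeated according to the dimension of their
  eigenspace.  A reversible transition matrix is diagonalizable over the reals, so for it this is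
  the full list of eigenvalues with algebraic multiplicity.
\<close>

definition eigenvalues :: "real ^ 'k::finite ^ 'k \<Rightarrow> real list" where
  "eigenvalues P = rev (sorted_list_of_multiset
     (\<Sum>\<mu> | eigenspace P \<mu> \<noteq> {0}. replicate_mset (dim (eigenspace P \<mu>)) \<mu>))"

definition spectral_gap :: "real ^ 'k::finite ^ 'k \<Rightarrow> real" where
  "spectral_gap P = 1 - eigenvalues P ! 1"

definition ergodic_flow :: "real ^ 'k::finite ^ 'k \<Rightarrow> real ^ 'k \<Rightarrow> 'k \<Rightarrow> 'k \<Rightarrow> real" where
  "ergodic_flow P \<pi> i j = \<pi> $ i * P $ i $ j"

definition interval_partition :: "real ^ 'k::finite \<Rightarrow> ('k \<Rightarrow> real set) \<Rightarrow> bool" where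
  "interval_partition \<pi> I \<longleftrightarrow>
     (\<forall>v. is_interval (I v) \<and> I v \<subseteq> {0..1} \<and> measure lebesgue (I v) = \<pi> $ v) \<and>
     (\<forall>u v. u \<noteq> v \<longrightarrow> negligible (I u \<inter> I v)) \<and>
     negligible ({0..1} - (\<Union>v. I v))"

definition continuize :: "('k::finite \<Rightarrow> real set) \<Rightarrow> 'k set \<Rightarrow> real set" where
  "continuize I A = (\<Union>v\<in>A. I v)"

definition flow ::
  "real ^ 'k::finite ^ 'k \<Rightarrow> real ^ 'k \<Rightarrow> ('k \<Rightarrow> real set) \<Rightarrow> real set \<Rightarrow> real set \<Rightarrow> real" where
  "flow P \<pi> I A B = (\<Sum>x\<in>UNIV. \<Sum>y\<in>UNIV.
     measure lebesgue (A \<inter> I x) / \<pi> $ x * (measure lebesgue (B \<inter> I y) / \<pi> $ y) *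
     ergodic_flow P \<pi> x y)"

definition subsets_of_measure ::
  "('k::finite \<Rightarrow> real set) \<Rightarrow> 'k set \<Rightarrow> real \<Rightarrow> real set set" where
  "subsets_of_measure I A t =
     {B. B \<in> sets lebesgue \<and> B \<subseteq> continuize I A \<and> measure lebesgue B = t}"

text \<open>
  The second argument below is \<open>A\<close>, not \<open>A\<^sup>c\<close>.  The complement of \<open>A\<close> is taken in \<open>K\<close> and then
  continuized, which agrees up to a null set with the complement in \<open>[0,1]\<close>.
\<close>

definition Psi ::
  "real ^ 'k::finite ^ 'k \<Rightarrow> real ^ 'k \<Rightarrow> ('k \<Rightarrow> real set) \<Rightarrow> real \<Rightarrow> 'k set \<Rightarrow> real" where
  "Psi P \<pi> I t A = (INF B\<in>subsets_of_measure I A t. flow P \<pi> I B (continuize I (- A)))"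

definition Psi_big ::
  "real ^ 'k::finite ^ 'k \<Rightarrow> real ^ 'k \<Rightarrow> ('k \<Rightarrow> real set) \<Rightarrow> real \<Rightarrow> 'k set \<Rightarrow> real" where
  "Psi_big P \<pi> I t A = (SUP B\<in>subsets_of_measure I A t. flow P \<pi> I B (continuize I (- A)))"

definition set_prob :: "real ^ 'k::finite \<Rightarrow> 'k set \<Rightarrow> real" where
  "set_prob \<pi> A = (\<Sum>v\<in>A. \<pi> $ v)"

definition psi_plus_set ::
  "real ^ 'k::finite ^ 'k \<Rightarrow> real ^ 'k \<Rightarrow> ('k \<Rightarrow> real set) \<Rightarrow> 'k set \<Rightarrow> real" where
  "psi_plus_set P \<pi> I A =
     integral {0..set_prob \<pi> A} (\<lambda>t. Psi P \<pi> I t A / (set_prob \<pi> A)\<^sup>2)"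

definition psi_big_set ::
  "real ^ 'k::finite ^ 'k \<Rightarrow> real ^ 'k \<Rightarrow> ('k \<Rightarrow> real set) \<Rightarrow> 'k set \<Rightarrow> real" where
  "psi_big_set P \<pi> I A =
     integral {0..set_prob \<pi> A} (\<lambda>t. Psi_big P \<pi> I t A / (set_prob \<pi> A)\<^sup>2)"

definition psi_plus ::
  "real ^ 'k::finite ^ 'k \<Rightarrow> real ^ 'k \<Rightarrow> ('k \<Rightarrow> real set) \<Rightarrow> real \<Rightarrow> real" where
  "psi_plus P \<pi> I x = (INF A\<in>{A. A \<noteq> {} \<and> set_prob \<pi> A \<le> x}. psi_plus_set P \<pi> I A)"

definition psi_big ::
  "real ^ 'k::finite ^ 'k \<Rightarrow> real ^ 'k \<Rightarrow> ('k \<Rightarrow> real set) \<Rightarrow> real \<Rightarrow> real" where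
  "psi_big P \<pi> I x = (INF A\<in>{A. A \<noteq> {} \<and> set_prob \<pi> A \<le> x}. psi_big_set P \<pi> I A)"

definition tv_dist :: "real ^ 'k::finite \<Rightarrow> real ^ 'k \<Rightarrow> real" where
  "tv_dist p \<pi> = 1 / 2 * (\<Sum>v\<in>UNIV. \<bar>p $ v - \<pi> $ v\<bar>)"

text \<open>
  For an ergodic chain and \<open>\<epsilon> > 0\<close> the convergence to \<open>\<pi>\<close> is uniform in the initial distribution, so
  each \<open>LEAST\<close> is attained and the maximum is over a finite nonempty set of natural numbers.
\<close>

definition mixing_time :: "real ^ 'k::finite ^ 'k \<Rightarrow> real ^ 'k \<Rightarrow> real \<Rightarrow> nat" where
  "mixing_time P \<pi> \<epsilon> =
     Max ((\<lambda>p. LEAST t. tv_dist (p v* mat_power P t) \<pi> \<le> \<epsilon>) ` {p. prob_vec p})"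

end

theory Submission
  imports Defs
begin

text \<open>
  Write \<open>e x = P(x, A\<^sup>c)\<close> for \<open>x \<in> A\<close>.  Filling \<open>A\<close> in increasing order of \<open>e\<close> shows
  \<open>\<psi>\<^sup>+(A) \<le> (\<Sum>x y\<in>A. \<pi> x * \<pi> y * min (e x) (e y)) / (2 * \<pi>(A)\<^sup>2)\<close>, and proportional filling shows
  \<open>\<psi>\<^sub>b\<^sub>i\<^sub>g(A) \<ge> Q(A, A\<^sup>c) / (2 * \<pi>(A))\<close>.  The upper bound on the gap is then the Rayleigh quotient of a
  centred indicator.

  For the lower bound on the gap, cut an eigenfunction of the second eigenvalue \<open>\<mu>\<close> off at zero, on the
  side whose support has measure at most \<open>1/2\<close>, and order the states by its values.  The
  increments of \<open>sqrt \<pi>(\<cdot>)\<close> along this order are the weights of a linear functional that the chain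
  contracts on each level set \<open>A\<close> by \<open>1 - \<psi>\<^sup>+(A)/4\<close>: this is the evolving-set bound, by
  \<open>sqrt (1 - z) \<le> 1 - z/2 - z\<^sup>2/8\<close> applied to the layers of \<open>e\<close>.  Comparing with \<open>\<mu>\<close> gives
  \<open>\<mu> \<le> 1 - \<psi>\<^sup>+(1/2)/4\<close>.

  The mixing time is bounded above by the \<open>L\<^sup>2(\<pi>)\<close> contraction of a lazy chain on mean-zero
  densities, and below by testing against the eigenfunction of \<open>\<mu>\<close>.
\<close>

subsection \<open>Rankings, layers and real inequalities\<close>

text \<open>For injective \<open>r\<close> and nonnegative \<open>p\<close>, the intervals of length
  \<open>p y\<close> starting at \<open>rank_prefix r p S y\<close> tile the interval from 0 to
  \<open>sum p S\<close>. The square root weights and the greedy filling are both read off from such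
  a tiling.\<close>

definition rank_prefix :: "('k \<Rightarrow> nat) \<Rightarrow> ('k \<Rightarrow> real) \<Rightarrow> 'k set \<Rightarrow> 'k \<Rightarrow> real" where
  "rank_prefix r p S y = (\<Sum>z | z \<in> S \<and> r z < r y. p z)"

text \<open>Ties of \<open>h\<close> are broken arbitrarily: the induction adds a largest element
  and ranks it above everything before it.\<close>

lemma ex_monotone_ranking:
  fixes h :: "'k \<Rightarrow> 'a::linorder"
  assumes "finite S"
  shows "\<exists>r :: 'k \<Rightarrow> nat. inj_on r S \<and> (\<forall>x\<in>S. \<forall>y\<in>S. r x < r y \<longrightarrow> h x \<le> h y)"
  using assms
proof (induction rule: finite_ranking_induct[where f = h])
  case empty
  then show ?case by auto
next
  case (insert x S)
  then obtain r :: "'k \<Rightarrow> nat" where r: "inj_on r S" "\<forall>x\<in>S. \<forall>y\<in>S. r x < r y \<longrightarrow> h x \<le> h y"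
    by blast
  show ?case
  proof (cases "x \<in> S")
    case True
    then show ?thesis using r by (metis insert_absorb)
  next
    case False
    \<comment> \<open>For empty \<open>S\<close> the \<open>Max\<close> is an unspecified number,
      which is harmless because \<open>lt\<close> is then vacuous.\<close>
    define r' where "r' = r(x := Suc (Max (r ` S)))"
    have lt: "r y < Suc (Max (r ` S))" if "y \<in> S" for y
      using that insert.hyps(1) by (simp add: less_Suc_eq_le)
    have "inj_on r' (insert x S)"
      using r(1) False lt unfolding r'_def inj_on_def by (metis fun_upd_apply insertE nat_neq_iff)
    moreover have "\<forall>u\<in>insert x S. \<forall>v\<in>insert x S. r' u < r' v \<longrightarrow> h u \<le> h v"
      using r(2) False lt insert.hyps(2) unfolding r'_def
      by (metis (mono_tags, lifting) fun_upd_apply insertE order_less_asym' order_refl)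
    ultimately show ?thesis by blast
  qed
qed

text \<open>The element of highest rank contributes the last increment and lies in no other prefix,
  so it can be split off. Used with \<open>F = sqrt\<close> and \<open>F = min t\<close>.\<close>

lemma sum_rank_prefix_telescope:
  fixes p :: "'k \<Rightarrow> real" and F :: "real \<Rightarrow> real"
  assumes "finite S" "inj_on r S"
  shows "(\<Sum>y\<in>S. F (rank_prefix r p S y + p y) - F (rank_prefix r p S y)) = F (sum p S) - F 0"
  using assms
proof (induction rule: finite_ranking_induct[where f = r])
  case empty
  then show ?case by simp
next
  case (insert x S)
  show ?case
  proof (cases "x \<in> S")
    case True
    then show ?thesis using insert by (simp add: insert_absorb)
  next
    case False
    have lt: "r y < r x" if "y \<in> S" for y
      using that insert.hyps(2)[OF that] insert.prems False by (metis inj_onD insertCI le_neq_implies_less)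
    have x: "rank_prefix r p (insert x S) x = sum p S"
      unfolding rank_prefix_def by (rule sum.cong) (use lt in auto)
    have y: "rank_prefix r p (insert x S) y = rank_prefix r p S y" if "y \<in> S" for y
      unfolding rank_prefix_def by (rule sum.cong) (use lt[OF that] in auto)
    have "(\<Sum>y\<in>S. F (rank_prefix r p (insert x S) y + p y) - F (rank_prefix r p (insert x S) y))
        = F (sum p S) - F 0"
      using insert by (simp add: y)
    then show ?thesis
      using insert.hyps False by (simp add: x add.commute)
  qed
qed

text \<open>Each \<open>g j\<close> is the integral over \<open>s\<close> of the indicator of
  \<open>s < g j\<close>, so the sum is the integral of its layer sums. As \<open>c\<close> may have
  any sign, this reduces inequalities linear in \<open>g\<close> to the level sets of
  \<open>g\<close>.\<close>

lemma layer_cake_nonneg: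
  fixes c g :: "'j \<Rightarrow> real"
  assumes "finite J" "\<And>j. j \<in> J \<Longrightarrow> 0 \<le> g j"
    and layers: "\<And>s. 0 \<le> s \<Longrightarrow> 0 \<le> (\<Sum>j | j \<in> J \<and> s < g j. c j)"
  shows "0 \<le> (\<Sum>j\<in>J. c j * g j)"
proof -
  define M where "M = (\<Sum>j\<in>J. g j)"
  have gM: "g j \<le> M" if "j \<in> J" for j
    unfolding M_def using assms that by (intro member_le_sum) auto
  have "((\<lambda>s. if s \<in> {0..g j} then 1 else 0 :: real) has_integral g j) {0..M}" if "j \<in> J" for j
  proof -
    have "((\<lambda>s. 1 :: real) has_integral g j) {0..g j}"
      using has_integral_const_real[of "1::real" 0 "g j"] assms(2)[OF that] by simp
    then show ?thesis
      using has_integral_restrict[of "{0..g j}" "{0..M}" "\<lambda>s. 1::real"] gM[OF that] by simp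
  qed
  then have *: "((\<lambda>s. if s < g j then 1 else 0 :: real) has_integral g j) {0..M}" if "j \<in> J" for j
    by (rule has_integral_spike_finite[of "{g j}", rotated 2]) (use that in auto)
  have "((\<lambda>s. \<Sum>j\<in>J. c j * (if s < g j then 1 else 0)) has_integral (\<Sum>j\<in>J. c j * g j)) {0..M}"
    using assms(1) by (intro has_integral_sum has_integral_mult_right *) auto
  then show ?thesis
  proof (rule has_integral_nonneg)
    fix s :: real assume "s \<in> {0..M}"
    moreover have "(\<Sum>j\<in>J. c j * (if s < g j then 1 else 0)) = (\<Sum>j | j \<in> J \<and> s < g j. c j)"
      using assms(1) by (simp add: sum.inter_filter if_distrib cong: if_cong)
    ultimately show "0 \<le> (\<Sum>j\<in>J. c j * (if s < g j then 1 else 0))"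
      using layers by simp
  qed
qed

text \<open>The right side is the second-order Taylor polynomial of \<open>sqrt\<close> at
  \<open>a\<close>. After scaling by \<open>z = x / a\<close>, its square exceeds
  \<open>1 - z\<close> by \<open>z ^ 3 / 8 + z ^ 4 / 64\<close>. The quadratic term is the source of
  the contraction rate.\<close>

lemma sqrt_diff_le:
  assumes "0 \<le> x" "x \<le> (a::real)" "0 < a"
  shows "sqrt (a - x) \<le> sqrt a - x / (2 * sqrt a) - x\<^sup>2 / (8 * a * sqrt a)"
proof -
  define b where "b = sqrt a"
  have b: "b > 0" "a = b\<^sup>2" using assms by (auto simp: b_def)
  define z where "z = x / b\<^sup>2"
  have z: "0 \<le> z" "z \<le> 1" "x = z * b\<^sup>2" using assms b by (auto simp: z_def field_simps)
  have "1 - z \<le> (1 - z / 2 - z\<^sup>2 / 8)\<^sup>2"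
  proof -
    have "(1 - z / 2 - z\<^sup>2 / 8)\<^sup>2 - (1 - z) = z ^ 3 / 8 + z ^ 4 / 64"
      by (simp add: field_simps power2_eq_square power3_eq_cube power4_eq_xxxx)
    also have "\<dots> \<ge> 0" using z by simp
    finally show ?thesis by simp
  qed
  moreover have "0 \<le> 1 - z / 2 - z\<^sup>2 / 8"
    using z power_le_one[of z 2] by simp
  ultimately have "sqrt (1 - z) \<le> 1 - z / 2 - z\<^sup>2 / 8"
    by (intro real_le_lsqrt) auto
  then have "b * sqrt (1 - z) \<le> b * (1 - z / 2 - z\<^sup>2 / 8)" using b by simp
  moreover have "sqrt (a - x) = b * sqrt (1 - z)"
  proof -
    have "a - x = b\<^sup>2 * (1 - z)" by (simp add: b z algebra_simps)
    then show ?thesis using b by (simp add: real_sqrt_mult)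
  qed
  moreover have "b * (1 - z / 2 - z\<^sup>2 / 8) = sqrt a - x / (2 * sqrt a) - x\<^sup>2 / (8 * a * sqrt a)"
    unfolding b_def[symmetric] z(3) b(2)
    using b(1) by (simp add: field_simps power2_eq_square)
  ultimately show ?thesis by simp
qed

text \<open>Concavity of the square root, seen by rationalizing the increments.\<close>

lemma sqrt_increment_antimono:
  assumes "0 \<le> s" "s \<le> t" "0 \<le> (d::real)"
  shows "sqrt (t + d) - sqrt t \<le> sqrt (s + d) - sqrt s"
proof (cases "s = 0 \<and> t = 0 \<or> d = 0")
  case True
  then show ?thesis by auto
next
  case False
  then have d: "d > 0" using assms by auto
  have *: "sqrt (u + d) - sqrt u = d / (sqrt (u + d) + sqrt u)" if "0 \<le> u" for u
  proof -
    have "sqrt (u + d) + sqrt u > 0" using that d by (simp add: add_pos_nonneg)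
    moreover have "(sqrt (u + d) - sqrt u) * (sqrt (u + d) + sqrt u) = d"
      using that d by (simp add: algebra_simps)
    ultimately show ?thesis by (simp add: field_simps)
  qed
  have "d / (sqrt (t + d) + sqrt t) \<le> d / (sqrt (s + d) + sqrt s)"
    using assms d by (intro divide_left_mono add_mono mult_pos_pos add_pos_nonneg) auto
  then show ?thesis using * assms by simp
qed

lemma sqrt_increment_le:
  assumes "0 < a" "a \<le> s" "0 \<le> (d::real)"
  shows "sqrt (s + d) - sqrt s \<le> d / (2 * sqrt a)"
proof -
  have "sqrt (s + d) - sqrt s \<le> sqrt (a + d) - sqrt a"
    using assms by (intro sqrt_increment_antimono) auto
  moreover have "sqrt (a + d) \<le> sqrt a + d / (2 * sqrt a)"
  proof (rule real_le_lsqrt)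
    show "a + d \<le> (sqrt a + d / (2 * sqrt a))\<^sup>2"
      using assms by (simp add: power2_sum power_divide)
  qed (use assms in auto)
  ultimately show ?thesis by linarith
qed

text \<open>The difference of the two sides vanishes at 0 and has derivative
  \<open>- (x\<^sup>2 / (1 - x))\<close>. The quadratic term is kept because it helps to pay for
  rounding in \<open>exp_decay_floor_bound\<close>.\<close>

lemma ln_one_minus_le_quadratic:
  assumes "0 \<le> c" "c < (1::real)"
  shows "ln (1 - c) \<le> - c - c\<^sup>2 / 2"
proof -
  define h where "h c = ln (1 - c) + c + c\<^sup>2 / 2" for c :: real
  have "h c \<le> h 0"
  proof (rule DERIV_nonpos_imp_nonincreasing[OF assms(1)])
    fix x :: real assume x: "0 \<le> x" "x \<le> c"
    have "(h has_real_derivative - (1 / (1 - x)) + 1 + x) (at x)"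
      unfolding h_def[abs_def] using x assms by (auto intro!: derivative_eq_intros simp: field_simps)
    moreover have "- (1 / (1 - x)) + 1 + x = - (x\<^sup>2 / (1 - x))"
      using x assms by (simp add: field_simps power2_eq_square)
    moreover have "- (x\<^sup>2 / (1 - x)) \<le> 0" using x assms by simp
    ultimately show "\<exists>y. (h has_real_derivative y) (at x) \<and> y \<le> 0" by metis
  qed
  then show ?thesis by (simp add: h_def)
qed

lemma has_integral_min:
  fixes u a :: real
  assumes "0 \<le> u" "u \<le> a"
  shows "((\<lambda>t. min t u) has_integral (a * u - u\<^sup>2 / 2)) {0..a}"
proof -
  have "((\<lambda>t. min t u) has_integral (u\<^sup>2 / 2)) {0..u}"
    by (rule has_integral_eq[where f = "\<lambda>t. t"]) (use ident_has_integral[OF assms(1)] in auto)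
  moreover have "((\<lambda>t. min t u) has_integral ((a - u) * u)) {u..a}"
    by (rule has_integral_eq[where f = "\<lambda>t. u"]) (use has_integral_const_real[of u u a] assms in auto)
  ultimately have "((\<lambda>t. min t u) has_integral (u\<^sup>2 / 2 + (a - u) * u)) {0..a}"
    by (rule has_integral_combine[OF assms])
  then show ?thesis by (simp add: algebra_simps power2_eq_square)
qed

text \<open>A chain started in \<open>S\<close> never leaves it, by induction on the number of steps
  with the first step split off. All later uses of irreducibility go through this closure
  property.\<close>

lemma irreducible_closed_imp_UNIV:
  assumes "irreducible_chain P" "S \<noteq> {}"
    and closed: "\<And>i j. i \<in> S \<Longrightarrow> j \<notin> S \<Longrightarrow> P $ i $ j = 0"
  shows "S = UNIV"
proof (rule ccontr)
  assume "S \<noteq> UNIV"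
  then obtain j where j: "j \<notin> S" by blast
  obtain i where i: "i \<in> S" using assms(2) by blast
  have "mat_power P t $ i $ j = 0" for t
    using i
  proof (induction t arbitrary: i)
    case 0
    then have "i \<noteq> j" using j by blast
    then show ?case by (simp add: mat_power_def mat_def)
  next
    case (Suc t)
    have "P $ i $ k * mat_power P t $ k $ j = 0" for k
      using Suc closed by (cases "k \<in> S") auto
    then have "(\<Sum>k\<in>UNIV. P $ i $ k * mat_power P t $ k $ j) = 0" by (intro sum.neutral) simp
    then show ?case by (simp add: mat_power_def matrix_matrix_mult_def)
  qed
  then show False using assms(1) unfolding irreducible_chain_def by (metis less_irrefl)
qed

text \<open>Meant for \<open>c\<close> a quarter of \<open>psi_plus P \<pi> I (1 / 2)\<close>,
  \<open>p\<close> the least stationary mass and \<open>X\<close> the claimed upper bound on the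
  mixing time. Times are integers, so the decay is available only at the floor of
  \<open>X\<close>.\<close>

lemma exp_decay_floor_bound:
  fixes c p \<mu> \<epsilon> X :: real
  assumes c: "0 < c" "c \<le> 1 / 16" and p: "0 < p" "p \<le> 1 / 2" and \<mu>: "0 \<le> \<mu>" "\<mu> \<le> 1 - c"
    and \<epsilon>: "0 < \<epsilon>" "\<epsilon> \<le> 1 / 2"
    and X: "c * X = ln (1 / p) / 2 + ln (1 / (2 * \<epsilon>))"
  shows "1 / 2 * (\<mu> ^ nat \<lfloor>X\<rfloor> * sqrt (1 / p - 1)) \<le> \<epsilon>"
proof -
  define N where "N = nat \<lfloor>X\<rfloor>"
  define L where "L = - ln p"
  define E where "E = - ln (2 * \<epsilon>)"
  have cX: "c * X = L / 2 + E" using X p \<epsilon> by (simp add: L_def E_def ln_div)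
  have E: "0 \<le> E" using \<epsilon> by (simp add: E_def)
  have N: "X - 1 \<le> real N" unfolding N_def by linarith
  text \<open>
    Rounding \<open>X\<close> down costs \<open>c + c\<^sup>2 / 2\<close> in the exponent; the quadratic term of
    \<open>ln (1 - c)\<close> and the bound \<open>ln (1 - p) \<le> - p\<close> make up for it.  The estimate of \<open>L\<close> is the
    tangent of \<open>- ln\<close> at \<open>1 / 32\<close>.
  \<close>
  have slack: "c + c\<^sup>2 / 2 \<le> c * L / 4 + p / 2"
  proof -
    have "ln (32 * p) \<le> 32 * p - 1" using p by (intro ln_le_minus_one) simp
    moreover have "ln (32 * p) = 5 * ln 2 + ln p"
    proof -
      have "ln (32 :: real) = ln (2 ^ 5)" by simp
      also have "\<dots> = 5 * ln 2" by (subst ln_realpow) auto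
      finally show ?thesis using p by (simp add: ln_mult)
    qed
    ultimately have "13 / 3 - 32 * p \<le> L" using ln2_ge_two_thirds by (simp add: L_def)
    then have "c * (13 / 3 - 32 * p) \<le> c * L" using c by (intro mult_left_mono) auto
    moreover have "c * p \<le> 1 / 16 * p" using c p by (intro mult_right_mono) auto
    moreover have "c * c \<le> 1 / 16 * c" using c by (intro mult_right_mono) auto
    moreover have "c * (13 / 3 - 32 * p) = 13 / 3 * c - 32 * (c * p)" by (simp add: algebra_simps)
    ultimately show ?thesis unfolding power2_eq_square using c by linarith
  qed
  have "\<mu> ^ N \<le> (1 - c) ^ N" using \<mu> by (intro power_mono) auto
  also have "\<dots> = exp (real N * ln (1 - c))" using c by (simp add: exp_of_nat_mult)
  finally have 1: "\<mu> ^ N \<le> exp (real N * ln (1 - c))" .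
  \<comment> \<open>Writing the square root factor as \<open>exp (y / 2)\<close> turns the claim
    into a linear inequality between exponents.\<close>
  define y where "y = ln (1 - p) - ln p"
  have "1 / p - 1 = exp y"
    using p by (simp add: y_def exp_diff field_simps)
  then have 2: "sqrt (1 / p - 1) = exp (y / 2)"
    using exp_double[of "y / 2"] by (intro real_sqrt_unique) auto
  have "real N * ln (1 - c) \<le> real N * (- c - c\<^sup>2 / 2)"
    using c by (intro mult_left_mono ln_one_minus_le_quadratic) auto
  also have "\<dots> \<le> (X - 1) * (- c - c\<^sup>2 / 2)"
  proof (rule mult_right_mono_neg[OF N])
    show "- c - c\<^sup>2 / 2 \<le> 0" using c(1) zero_le_power2[of c] by linarith
  qed
  also have "\<dots> = - (c * X) - c * (c * X) / 2 + (c + c\<^sup>2 / 2)"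
    by (simp add: field_simps power2_eq_square)
  also have "\<dots> = - (L / 2 + E) - c * (L / 2 + E) / 2 + (c + c\<^sup>2 / 2)" by (simp only: cX)
  finally have "real N * ln (1 - c) \<le> - (L / 2 + E) - c * L / 4 - c * E / 2 + (c + c\<^sup>2 / 2)"
    by (simp add: field_simps)
  moreover have "0 \<le> c * E" using c E by simp
  moreover have "ln (1 - p) \<le> - p" using p ln_one_minus_pos_upper_bound[of p] by simp
  moreover have "y = ln (1 - p) + L" by (simp add: y_def L_def)
  ultimately have "real N * ln (1 - c) + y / 2 \<le> - E"
    using slack by linarith
  then have "exp (real N * ln (1 - c)) * exp (y / 2) \<le> exp (- E)"
    unfolding exp_add[symmetric] by simp
  also have "exp (- E) = 2 * \<epsilon>" using \<epsilon> by (simp add: E_def)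
  finally have "exp (real N * ln (1 - c)) * sqrt (1 / p - 1) \<le> 2 * \<epsilon>" unfolding 2 .
  moreover have "\<mu> ^ N * sqrt (1 / p - 1) \<le> exp (real N * ln (1 - c)) * sqrt (1 / p - 1)"
    using 1 p by (intro mult_right_mono) (auto simp: field_simps)
  ultimately show ?thesis unfolding N_def[symmetric] by simp
qed

text \<open>If \<open>1 \<le> 4 * b\<close>, the left side is not positive. Otherwise
  \<open>- ln \<mu> \<le> 1 / \<mu> - 1\<close> bounds the logarithm by
  \<open>N * (1 - \<mu>) / \<mu>\<close>, and the prefactor absorbs
  \<open>(1 - \<mu>) / \<mu>\<close> because \<open>1 - 4 * b \<le> \<mu>\<close> and
  \<open>1 - \<mu> \<le> 4 * b\<close>.\<close>

lemma relaxation_lower_bound: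
  fixes \<mu> \<epsilon> b :: real and N :: nat
  assumes \<mu>: "0 \<le> \<mu>" "\<mu> < 1" and b: "1 - \<mu> \<le> 4 * b" and \<epsilon>: "0 < \<epsilon>" "\<epsilon> \<le> 1 / 2"
    and decay: "\<mu> ^ N \<le> 2 * \<epsilon>"
  shows "(1 - 4 * b) / (8 * b) * ln (1 / (2 * \<epsilon>)) \<le> real N"
proof (cases "1 \<le> 4 * b")
  case True
  then have "(1 - 4 * b) / (8 * b) \<le> 0" by (simp add: divide_nonpos_pos)
  moreover have "0 \<le> ln (1 / (2 * \<epsilon>))" using \<epsilon> by simp
  ultimately have "(1 - 4 * b) / (8 * b) * ln (1 / (2 * \<epsilon>)) \<le> 0" by (rule mult_nonpos_nonneg)
  then show ?thesis by linarith
next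
  case False
  then have m: "0 < \<mu>" "0 < b" using \<mu> b by auto
  have "real N * ln \<mu> \<le> ln (2 * \<epsilon>)"
    using decay m \<epsilon> ln_le_cancel_iff[of "\<mu> ^ N" "2 * \<epsilon>"] by (simp add: ln_realpow)
  then have "ln (1 / (2 * \<epsilon>)) \<le> real N * (- ln \<mu>)" using \<epsilon> by (simp add: ln_div)
  also have "- ln \<mu> = ln (1 / \<mu>)" using m by (simp add: ln_div)
  also have "\<dots> \<le> 1 / \<mu> - 1" using m by (intro ln_le_minus_one) simp
  finally have E: "ln (1 / (2 * \<epsilon>)) \<le> real N * (1 / \<mu> - 1)" by (simp add: mult_left_mono)
  have "(1 - 4 * b) / (8 * b) * (1 / \<mu> - 1) \<le> 1"
  proof -
    have "(1 - 4 * b) * (1 - \<mu>) \<le> \<mu> * (4 * b)"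
      using b False \<mu> by (intro mult_mono) auto
    also have "\<dots> \<le> \<mu> * (8 * b)" using m by simp
    finally show ?thesis using m by (simp add: field_simps)
  qed
  then have "real N * ((1 - 4 * b) / (8 * b) * (1 / \<mu> - 1)) \<le> real N * 1"
    by (intro mult_left_mono) auto
  moreover have "(1 - 4 * b) / (8 * b) * ln (1 / (2 * \<epsilon>)) \<le> (1 - 4 * b) / (8 * b) * (real N * (1 / \<mu> - 1))"
    using E m False by (intro mult_left_mono) auto
  ultimately show ?thesis by (simp add: mult_ac)
qed

subsection \<open>Spectral theory of lazy reversible chains\<close>

text \<open>The word positive refers to \<open>\<pi>\<close>. Stationarity follows from
  \<open>rev\<close> and \<open>P_sum\<close>.\<close>

locale positive_reversible_chain =
  fixes P :: "real ^ 'k::finite ^ 'k" and \<pi> :: "real ^ 'k"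
  assumes P_nonneg: "0 \<le> P $ i $ j"
    and P_sum: "(\<Sum>j\<in>UNIV. P $ i $ j) = 1"
    and pi_pos: "0 < \<pi> $ i"
    and pi_sum: "(\<Sum>i\<in>UNIV. \<pi> $ i) = 1"
    and rev: "\<pi> $ i * P $ i $ j = \<pi> $ j * P $ j $ i"
begin

section \<open>Escape probabilities, cuts and the square root contraction\<close>

definition escape :: "'k set \<Rightarrow> 'k \<Rightarrow> real" where
  "escape A x = (\<Sum>y\<in>-A. P $ x $ y)"

definition cut_flow :: "'k set \<Rightarrow> real" where
  "cut_flow A = (\<Sum>x\<in>A. \<pi> $ x * escape A x)"

text \<open>By layers, this is the integral over \<open>s\<close> of the squared mass of the states
  of \<open>A\<close> whose escape probability exceeds \<open>s\<close>. It links the second-order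
  loss in \<open>sqrt_weight_contraction\<close> to the integral of \<open>Psi\<close>, of which
  half of it is an upper bound.\<close>

definition min_flow :: "'k set \<Rightarrow> real" where
  "min_flow A = (\<Sum>x\<in>A. \<Sum>y\<in>A. \<pi> $ x * \<pi> $ y * min (escape A x) (escape A y))"

lemma pi_nonneg [simp]: "0 \<le> \<pi> $ i"
  using pi_pos less_imp_le by blast

lemma set_prob_nonneg [simp]: "0 \<le> set_prob \<pi> A"
  by (simp add: set_prob_def sum_nonneg)

lemma set_prob_pos: "A \<noteq> {} \<Longrightarrow> 0 < set_prob \<pi> A"
  unfolding set_prob_def by (rule sum_pos) (auto simp: pi_pos)

lemma set_prob_Compl: "set_prob \<pi> (- A) = 1 - set_prob \<pi> A"
  using sum.subset_diff[of A UNIV "\<lambda>i. \<pi> $ i"] pi_sum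
  by (simp add: set_prob_def Compl_eq_Diff_UNIV)

lemma escape_nonneg [simp]: "0 \<le> escape A x"
  by (simp add: escape_def P_nonneg sum_nonneg)

lemma sum_P_in: "(\<Sum>y\<in>A. P $ x $ y) = 1 - escape A x"
  using sum.subset_diff[of A UNIV "\<lambda>y. P $ x $ y"] P_sum[of x]
  by (simp add: escape_def Compl_eq_Diff_UNIV)

lemma escape_le_1: "escape A x \<le> 1"
  using sum_nonneg[of A "\<lambda>y. P $ x $ y"] P_nonneg sum_P_in[of x A] by simp

text \<open>Reversibility equates the flow into \<open>A\<close>, which is what the states outside
  \<open>A\<close> contribute in \<open>sqrt_weight_contraction\<close>, with the flow out of
  \<open>A\<close>.\<close>

lemma cut_flow_symmetric: "(\<Sum>x\<in>-A. \<pi> $ x * (\<Sum>y\<in>A. P $ x $ y)) = cut_flow A"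
proof -
  have "(\<Sum>x\<in>-A. \<pi> $ x * (\<Sum>y\<in>A. P $ x $ y)) = (\<Sum>x\<in>-A. \<Sum>y\<in>A. \<pi> $ y * P $ y $ x)"
    by (simp add: sum_distrib_left rev)
  also have "\<dots> = (\<Sum>y\<in>A. \<Sum>x\<in>-A. \<pi> $ y * P $ y $ x)"
    by (rule sum.swap)
  finally show ?thesis by (simp add: cut_flow_def escape_def sum_distrib_left)
qed

text \<open>
  The hypotheses on \<open>w\<close> hold for the increments of \<open>sqrt \<circ> set_prob \<pi>\<close> along a chain of sets
  through \<open>A\<close>.
\<close>

lemma sqrt_weight_contraction:
  assumes A: "A \<noteq> {}"
    and w_A: "(\<Sum>y\<in>A. w y) = sqrt (set_prob \<pi> A)"
    and w_sub: "\<And>C. C \<subseteq> A \<Longrightarrow> (\<Sum>y\<in>C. w y) \<le> sqrt (set_prob \<pi> C)"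
    and w_out: "\<And>y. y \<notin> A \<Longrightarrow> w y \<le> \<pi> $ y / (2 * sqrt (set_prob \<pi> A))"
  shows "(\<Sum>y\<in>UNIV. w y * (\<Sum>z\<in>A. P $ y $ z))
    \<le> (1 - min_flow A / (8 * (set_prob \<pi> A)\<^sup>2)) * sqrt (set_prob \<pi> A)"
proof -
  define a where "a = set_prob \<pi> A"
  define e where "e = escape A"
  have a: "0 < a" using set_prob_pos[OF A] by (simp add: a_def)
  define k where "k = 1 / (8 * a * sqrt a)"
  \<comment> \<open>The linear part sits on the diagonal, where \<open>g (y, y) = e y\<close>, and
    the quadratic part on all pairs. A layer of \<open>g\<close> is a square
    \<open>C \<times> C\<close>, so its coefficients add up to the linear and quadratic terms of
    \<open>sqrt_diff_le\<close> at \<open>x = set_prob \<pi> C\<close>.\<close>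
  define c where "c = (\<lambda>(y, z). (if y = z then w y - \<pi> $ y / (2 * sqrt a) else 0) - k * (\<pi> $ y * \<pi> $ z))"
  define g where "g = (\<lambda>(y, z). min (e y) (e z))"
  have "0 \<le> (\<Sum>j\<in>A \<times> A. c j * g j)"
  proof (rule layer_cake_nonneg)
    fix s :: real assume "0 \<le> s"
    define C where "C = {y \<in> A. s < e y}"
    define x where "x = set_prob \<pi> C"
    have CA: "C \<subseteq> A" by (auto simp: C_def)
    have "{j. j \<in> A \<times> A \<and> s < g j} = C \<times> C" by (auto simp: C_def g_def)
    then have "(\<Sum>j | j \<in> A \<times> A \<and> s < g j. c j) = (\<Sum>y\<in>C. \<Sum>z\<in>C. c (y, z))"
      by (simp add: sum.cartesian_product)
    also have "\<dots> = (\<Sum>y\<in>C. w y - \<pi> $ y / (2 * sqrt a)) - k * (\<Sum>y\<in>C. \<Sum>z\<in>C. \<pi> $ y * \<pi> $ z)"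
      by (simp add: c_def sum_subtractf sum_distrib_left)
    also have "(\<Sum>y\<in>C. \<Sum>z\<in>C. \<pi> $ y * \<pi> $ z) = x\<^sup>2"
      by (simp add: x_def set_prob_def power2_eq_square sum_product)
    also have "(\<Sum>y\<in>C. w y - \<pi> $ y / (2 * sqrt a)) - k * x\<^sup>2
        = (\<Sum>y\<in>C. w y) - x / (2 * sqrt a) - x\<^sup>2 / (8 * a * sqrt a)"
      by (simp add: sum_subtractf x_def set_prob_def sum_divide_distrib k_def)
    finally have 1: "(\<Sum>j | j \<in> A \<times> A \<and> s < g j. c j) = \<dots>" .
    have split: "sum h A = sum h (A - C) + sum h C" for h :: "'k \<Rightarrow> real"
      using CA by (intro sum.subset_diff) auto
    have "set_prob \<pi> (A - C) = a - x"
      using split[of "\<lambda>i. \<pi> $ i"] by (simp add: a_def x_def set_prob_def)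
    \<comment> \<open>An upper bound for the weight of \<open>A - C\<close> is a lower bound for
      that of \<open>C\<close>, because the total weight of \<open>A\<close> is known
      exactly.\<close>
    then have "(\<Sum>y\<in>A - C. w y) \<le> sqrt (a - x)"
      using w_sub[of "A - C"] by simp
    moreover have "(\<Sum>y\<in>A. w y) = sqrt a" using w_A by (simp add: a_def)
    moreover have "sqrt (a - x) \<le> sqrt a - x / (2 * sqrt a) - x\<^sup>2 / (8 * a * sqrt a)"
    proof (rule sqrt_diff_le)
      show "x \<le> a" unfolding x_def a_def set_prob_def using CA by (intro sum_mono2) auto
    qed (use a in \<open>auto simp: x_def\<close>)
    ultimately show "0 \<le> (\<Sum>j | j \<in> A \<times> A \<and> s < g j. c j)"
      using split[of w] unfolding 1 by linarith
  qed (auto simp: g_def e_def)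
  also have "(\<Sum>j\<in>A \<times> A. c j * g j) = (\<Sum>y\<in>A. \<Sum>z\<in>A. c (y, z) * g (y, z))"
    by (simp add: sum.cartesian_product)
  also have "\<dots> = (\<Sum>y\<in>A. \<Sum>z\<in>A. (if y = z then (w y - \<pi> $ y / (2 * sqrt a)) * e y else 0)
      - k * (\<pi> $ y * \<pi> $ z * min (e y) (e z)))"
    by (intro sum.cong) (auto simp: c_def g_def algebra_simps)
  also have "\<dots> = (\<Sum>y\<in>A. (w y - \<pi> $ y / (2 * sqrt a)) * e y) - k * min_flow A"
    by (simp add: sum_subtractf min_flow_def e_def sum_distrib_left)
  also have "(\<Sum>y\<in>A. (w y - \<pi> $ y / (2 * sqrt a)) * e y)
      = (\<Sum>y\<in>A. w y * e y) - cut_flow A / (2 * sqrt a)"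
    by (simp add: cut_flow_def e_def left_diff_distrib sum_subtractf sum_divide_distrib)
  finally have inside: "(\<Sum>y\<in>A. w y * e y) \<ge> cut_flow A / (2 * sqrt a) + k * min_flow A"
    by simp
  have "(\<Sum>y\<in>-A. w y * (\<Sum>z\<in>A. P $ y $ z)) \<le> (\<Sum>y\<in>-A. \<pi> $ y / (2 * sqrt a) * (\<Sum>z\<in>A. P $ y $ z))"
    using w_out by (intro sum_mono mult_right_mono sum_nonneg) (auto simp: a_def P_nonneg)
  also have "\<dots> = cut_flow A / (2 * sqrt a)"
    by (simp add: cut_flow_symmetric[symmetric] sum_divide_distrib)
  finally have outside: "(\<Sum>y\<in>-A. w y * (\<Sum>z\<in>A. P $ y $ z)) \<le> cut_flow A / (2 * sqrt a)" .
  have "(\<Sum>y\<in>UNIV. w y * (\<Sum>z\<in>A. P $ y $ z))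
      = (\<Sum>y\<in>-A. w y * (\<Sum>z\<in>A. P $ y $ z)) + (\<Sum>y\<in>A. w y * (\<Sum>z\<in>A. P $ y $ z))"
    using sum.subset_diff[of A UNIV "\<lambda>y. w y * (\<Sum>z\<in>A. P $ y $ z)"] by (simp add: Compl_eq_Diff_UNIV)
  also have "(\<Sum>y\<in>A. w y * (\<Sum>z\<in>A. P $ y $ z)) = sqrt a - (\<Sum>y\<in>A. w y * e y)"
    by (simp add: sum_P_in e_def right_diff_distrib sum_subtractf w_A a_def)
  \<comment> \<open>The first-order terms \<open>cut_flow A / (2 * sqrt a)\<close> from
    \<open>inside\<close> and \<open>outside\<close> cancel.\<close>
  finally have "(\<Sum>y\<in>UNIV. w y * (\<Sum>z\<in>A. P $ y $ z)) \<le> sqrt a - k * min_flow A"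
    using inside outside by linarith
  also have "k = sqrt a / (8 * a\<^sup>2)"
    using a by (simp add: k_def field_simps power2_eq_square)
  finally show ?thesis by (simp add: a_def algebra_simps)
qed

text \<open>
  Truncating an eigenfunction at zero gives \<open>g\<close> with \<open>\<mu> g \<le> P g\<close>.  The functional
  \<open>\<integral> sqrt (set_prob \<pi> {g > s}) ds\<close> agrees on \<open>g\<close> with the linear functional of weights \<open>w\<close>,
  and \<open>w\<close> contracts the indicator of every level set.
\<close>

lemma truncated_eigenvalue_bound:
  assumes g_nonneg: "\<And>x. 0 \<le> g x" and "\<exists>x. 0 < g x"
    and super: "\<And>x. \<mu> * g x \<le> (\<Sum>y\<in>UNIV. P $ x $ y * g y)"
    and small: "set_prob \<pi> {x. 0 < g x} \<le> x0"
    and c: "\<And>A. A \<noteq> {} \<Longrightarrow> set_prob \<pi> A \<le> x0 \<Longrightarrow> c \<le> min_flow A / (8 * (set_prob \<pi> A)\<^sup>2)"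
  shows "\<mu> \<le> 1 - c"
proof -
  \<comment> \<open>Large values of \<open>g\<close> come first, so every level set of
    \<open>g\<close> is an initial segment of the ranking and \<open>w\<close> telescopes over
    it.\<close>
  obtain r :: "'k \<Rightarrow> nat" where r: "inj r" "\<And>x y. r x < r y \<Longrightarrow> g y \<le> g x"
    using ex_monotone_ranking[of "UNIV :: 'k set" "\<lambda>x. - g x"] by auto
  define s where "s = rank_prefix r (($) \<pi>) UNIV"
  define w where "w y = sqrt (s y + \<pi> $ y) - sqrt (s y)" for y
  have s_nonneg: "0 \<le> s y" for y
    by (simp add: s_def rank_prefix_def sum_nonneg)
  have w_pos: "0 < w y" for y
    using pi_pos[of y] by (simp add: w_def)
  have tele: "(\<Sum>y\<in>C. sqrt (rank_prefix r (($) \<pi>) C y + \<pi> $ y) - sqrt (rank_prefix r (($) \<pi>) C y))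
      = sqrt (set_prob \<pi> C)" for C
    using sum_rank_prefix_telescope[of C r sqrt "($) \<pi>"] r(1)
    by (simp add: set_prob_def inj_on_subset[of r UNIV C])
  have w_le: "(\<Sum>y\<in>C. w y) \<le> sqrt (set_prob \<pi> C)" for C
  proof -
    \<comment> \<open>Restricting to \<open>C\<close> only shortens the prefix before
      \<open>y\<close>, and by concavity an earlier increment is larger.\<close>
    have "w y \<le> sqrt (rank_prefix r (($) \<pi>) C y + \<pi> $ y) - sqrt (rank_prefix r (($) \<pi>) C y)" for y
      unfolding w_def s_def rank_prefix_def
      by (intro sqrt_increment_antimono sum_mono2 sum_nonneg) auto
    then show ?thesis unfolding tele[symmetric] by (intro sum_mono) auto
  qed
  have level: "(\<Sum>y\<in>UNIV. w y * (\<Sum>z | t < g z. P $ y $ z)) \<le> (1 - c) * (\<Sum>y | t < g y. w y)"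
    if "0 \<le> t" for t
  proof (cases "{y. t < g y} = {}")
    case True
    then show ?thesis by simp
  next
    case False
    define A where "A = {y. t < g y}"
    have prefix: "rank_prefix r (($) \<pi>) A y = s y" if "y \<in> A" for y
      unfolding s_def rank_prefix_def
      by (rule sum.cong) (use that r(2) in \<open>force simp: A_def\<close>)+
    have w_A: "(\<Sum>y\<in>A. w y) = sqrt (set_prob \<pi> A)"
      unfolding tele[of A, symmetric] by (simp add: w_def prefix)
    have "(\<Sum>y\<in>UNIV. w y * (\<Sum>z\<in>A. P $ y $ z))
        \<le> (1 - min_flow A / (8 * (set_prob \<pi> A)\<^sup>2)) * sqrt (set_prob \<pi> A)"
    proof (rule sqrt_weight_contraction)
      show "A \<noteq> {}" using False by (simp add: A_def)
      fix y assume y: "y \<notin> A"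
      \<comment> \<open>A state outside the level set comes after all of it, so its increment starts
        at height at least \<open>set_prob \<pi> A\<close>.\<close>
      have "r z < r y" if "z \<in> A" for z
      proof (rule ccontr)
        assume "\<not> r z < r y"
        then have "r y < r z" using that y inj_eq[OF r(1)] by (metis linorder_neqE_nat)
        then show False using r(2) that y by (force simp: A_def)
      qed
      then have "set_prob \<pi> A \<le> s y"
        unfolding set_prob_def s_def rank_prefix_def by (intro sum_mono2) auto
      then show "w y \<le> \<pi> $ y / (2 * sqrt (set_prob \<pi> A))"
        unfolding w_def using False by (intro sqrt_increment_le set_prob_pos) (auto simp: A_def)
    qed (auto simp: w_A w_le)
    also have "\<dots> \<le> (1 - c) * sqrt (set_prob \<pi> A)"
    proof (intro mult_right_mono diff_mono order_refl c)
      have "set_prob \<pi> A \<le> set_prob \<pi> {x. 0 < g x}"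
        unfolding set_prob_def A_def using \<open>0 \<le> t\<close> by (intro sum_mono2) auto
      then show "set_prob \<pi> A \<le> x0" using small by simp
    qed (use False in \<open>auto simp: A_def\<close>)
    finally show ?thesis using w_A by (simp add: A_def)
  qed
  \<comment> \<open>The weights do not depend on the level, so the bound \<open>level\<close>
    integrates over \<open>t\<close> to the same bound for \<open>g\<close>.\<close>
  have "0 \<le> (\<Sum>z\<in>UNIV. ((1 - c) * w z - (\<Sum>y\<in>UNIV. w y * P $ y $ z)) * g z)"
  proof (rule layer_cake_nonneg)
    fix t :: real assume "0 \<le> t"
    have "(\<Sum>z | z \<in> UNIV \<and> t < g z. (1 - c) * w z - (\<Sum>y\<in>UNIV. w y * P $ y $ z))
        = (1 - c) * (\<Sum>z | t < g z. w z) - (\<Sum>z | t < g z. \<Sum>y\<in>UNIV. w y * P $ y $ z)"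
      by (simp add: sum_subtractf sum_distrib_left)
    also have "(\<Sum>z | t < g z. \<Sum>y\<in>UNIV. w y * P $ y $ z) = (\<Sum>y\<in>UNIV. w y * (\<Sum>z | t < g z. P $ y $ z))"
      unfolding sum_distrib_left by (rule sum.swap)
    finally show "0 \<le> (\<Sum>z | z \<in> UNIV \<and> t < g z. (1 - c) * w z - (\<Sum>y\<in>UNIV. w y * P $ y $ z))"
      using level[OF \<open>0 \<le> t\<close>] by simp
  qed (auto simp: g_nonneg)
  also have "\<dots> = (1 - c) * (\<Sum>z\<in>UNIV. w z * g z) - (\<Sum>z\<in>UNIV. \<Sum>y\<in>UNIV. w y * P $ y $ z * g z)"
    by (simp add: left_diff_distrib sum_subtractf sum_distrib_left sum_distrib_right mult.assoc)
  also have "(\<Sum>z\<in>UNIV. \<Sum>y\<in>UNIV. w y * P $ y $ z * g z) = (\<Sum>y\<in>UNIV. w y * (\<Sum>z\<in>UNIV. P $ y $ z * g z))"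
    unfolding sum_distrib_left by (subst sum.swap) (simp add: mult.assoc)
  finally have "(\<Sum>y\<in>UNIV. w y * (\<Sum>z\<in>UNIV. P $ y $ z * g z)) \<le> (1 - c) * (\<Sum>z\<in>UNIV. w z * g z)"
    by simp
  moreover have "\<mu> * (\<Sum>y\<in>UNIV. w y * g y) \<le> (\<Sum>y\<in>UNIV. w y * (\<Sum>z\<in>UNIV. P $ y $ z * g z))"
    unfolding sum_distrib_left[of \<mu>]
  proof (rule sum_mono)
    fix y
    have "w y * (\<mu> * g y) \<le> w y * (\<Sum>z\<in>UNIV. P $ y $ z * g z)"
      using w_pos[of y] super[of y] by (intro mult_left_mono) auto
    then show "\<mu> * (w y * g y) \<le> w y * (\<Sum>z\<in>UNIV. P $ y $ z * g z)"
      by (simp add: ac_simps)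
  qed
  moreover have "0 < (\<Sum>z\<in>UNIV. w z * g z)"
    using assms(2) w_pos g_nonneg by (auto intro!: sum_pos2 mult_pos_pos simp: less_imp_le)
  ultimately show ?thesis
    by (meson mult_le_cancel_right_pos order_trans)
qed

section \<open>The inner product weighted by \<open>\<pi>\<close>\<close>

definition mean :: "real ^ 'k \<Rightarrow> real" where
  "mean f = (\<Sum>i\<in>UNIV. \<pi> $ i * f $ i)"

definition ip :: "real ^ 'k \<Rightarrow> real ^ 'k \<Rightarrow> real" where
  "ip f g = (\<Sum>i\<in>UNIV. \<pi> $ i * (f $ i * g $ i))"

lemma ip_commute: "ip f g = ip g f"
  by (simp add: ip_def mult.commute)

lemma ip_add_left: "ip (f + g) h = ip f h + ip g h"
  by (simp add: ip_def algebra_simps sum.distrib)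

lemma ip_diff_left: "ip (f - g) h = ip f h - ip g h"
  by (simp add: ip_def algebra_simps sum_subtractf)

lemma ip_scale_left: "ip (c *\<^sub>R f) h = c * ip f h"
  by (simp add: ip_def algebra_simps sum_distrib_left)

lemma ip_add_right: "ip h (f + g) = ip h f + ip h g"
  by (simp add: ip_def algebra_simps sum.distrib)

lemma ip_diff_right: "ip h (f - g) = ip h f - ip h g"
  by (simp add: ip_def algebra_simps sum_subtractf)

lemma ip_scale_right: "ip h (c *\<^sub>R f) = c * ip h f"
  by (simp add: ip_def algebra_simps sum_distrib_left)

lemmas ip_simps = ip_add_left ip_diff_left ip_scale_left ip_add_right ip_diff_right ip_scale_right

lemma ip_nonneg [simp]: "0 \<le> ip f f"
  by (simp add: ip_def sum_nonneg)

lemma ip_pos: "f \<noteq> 0 \<Longrightarrow> 0 < ip f f"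
proof -
  assume "f \<noteq> 0"
  then obtain i where i: "f $ i \<noteq> 0" by (auto simp: vec_eq_iff)
  then have "0 < f $ i * f $ i" using not_real_square_gt_zero by blast
  then have "0 < \<pi> $ i * (f $ i * f $ i)" using pi_pos[of i] by simp
  then show ?thesis unfolding ip_def by (intro sum_pos2[where i = i]) auto
qed

lemma mean_ip: "mean f = ip 1 f"
  by (simp add: mean_def ip_def)

lemma matrix_vector_component: "(P *v f) $ i = (\<Sum>j\<in>UNIV. P $ i $ j * f $ j)"
  by (simp add: matrix_vector_mult_def)

lemma ip_P: "ip f (P *v g) = (\<Sum>i\<in>UNIV. \<Sum>j\<in>UNIV. \<pi> $ i * P $ i $ j * (f $ i * g $ j))"
  by (simp add: ip_def matrix_vector_component sum_distrib_left ac_simps)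

lemma ip_P_swap: "ip (P *v f) g = ip f (P *v g)"
proof -
  have "ip g (P *v f) = (\<Sum>j\<in>UNIV. \<Sum>i\<in>UNIV. \<pi> $ i * P $ i $ j * (g $ i * f $ j))"
    unfolding ip_P by (rule sum.swap)
  also have "\<dots> = ip f (P *v g)"
    unfolding ip_P by (intro sum.cong refl) (simp only: rev mult.commute[of "g $ _"])
  finally show ?thesis by (simp add: ip_commute)
qed

lemma P_one: "P *v 1 = 1"
  by (simp add: vec_eq_iff matrix_vector_component P_sum)

lemma mean_P: "mean (P *v f) = mean f"
  using ip_P_swap[of 1 f] by (simp add: mean_ip P_one)

lemma mean_simps [simp]:
  "mean (f + g) = mean f + mean g" "mean (f - g) = mean f - mean g" "mean (c *\<^sub>R f) = c * mean f"
  "mean 1 = 1"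
  by (simp_all add: mean_ip ip_simps) (simp add: ip_def pi_sum)

lemma diagonal_sums:
  "(\<Sum>i\<in>UNIV. \<Sum>j\<in>UNIV. \<pi> $ i * P $ i $ j * (f $ i)\<^sup>2) = ip f f"
  "(\<Sum>i\<in>UNIV. \<Sum>j\<in>UNIV. \<pi> $ i * P $ i $ j * (f $ j)\<^sup>2) = ip f f"
proof -
  show 1: "(\<Sum>i\<in>UNIV. \<Sum>j\<in>UNIV. \<pi> $ i * P $ i $ j * (f $ i)\<^sup>2) = ip f f"
    by (simp add: sum_distrib_right[symmetric] sum_distrib_left[symmetric] P_sum ip_def
        power2_eq_square mult.assoc)
  have "(\<Sum>i\<in>UNIV. \<Sum>j\<in>UNIV. \<pi> $ i * P $ i $ j * (f $ j)\<^sup>2)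
      = (\<Sum>j\<in>UNIV. \<Sum>i\<in>UNIV. \<pi> $ j * P $ j $ i * (f $ j)\<^sup>2)"
    by (subst sum.swap) (simp only: rev)
  then show "(\<Sum>i\<in>UNIV. \<Sum>j\<in>UNIV. \<pi> $ i * P $ i $ j * (f $ j)\<^sup>2) = ip f f"
    using 1 by simp
qed

text \<open>Expanding the square gives the quadratic form of identity plus \<open>P\<close> as a sum
  of nonnegative terms, whose diagonal part laziness bounds from below.\<close>

lemma ip_P_plus:
  "2 * ip f (P *v f) + 2 * ip f f = (\<Sum>i\<in>UNIV. \<Sum>j\<in>UNIV. \<pi> $ i * P $ i $ j * (f $ i + f $ j)\<^sup>2)"
proof -
  have "(\<Sum>i\<in>UNIV. \<Sum>j\<in>UNIV. \<pi> $ i * P $ i $ j * (f $ i + f $ j)\<^sup>2)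
      = (\<Sum>i\<in>UNIV. \<Sum>j\<in>UNIV. \<pi> $ i * P $ i $ j * (f $ i)\<^sup>2 + \<pi> $ i * P $ i $ j * (f $ j)\<^sup>2
          + 2 * (\<pi> $ i * P $ i $ j * (f $ i * f $ j)))"
    by (intro sum.cong refl) (simp add: power2_eq_square algebra_simps)
  also have "\<dots> = ip f f + ip f f + 2 * ip f (P *v f)"
    unfolding sum.distrib diagonal_sums ip_P sum_distrib_left[symmetric] ..
  finally show ?thesis by simp
qed

end

text \<open>Irreducibility is assumed as the absence of proper closed sets. The second state
  provides a nonzero function of mean zero and a state of mass at most \<open>1 / 2\<close>.\<close>

locale lazy_reversible_chain = positive_reversible_chain P \<pi>
  for P :: "real ^ 'k::finite ^ 'k" and \<pi> :: "real ^ 'k" +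
  assumes lazy: "1 / 2 \<le> P $ i $ i"
    and closed_imp_UNIV: "S \<noteq> {} \<Longrightarrow> (\<And>i j. i \<in> S \<Longrightarrow> j \<notin> S \<Longrightarrow> P $ i $ j = 0) \<Longrightarrow> S = UNIV"
    and two_states: "2 \<le> CARD('k)"
begin

text \<open>By laziness the diagonal terms in \<open>ip_P_plus\<close> alone amount to at least
  \<open>2 * ip f f\<close>. Hence \<open>P\<close> has no negative eigenvalues, and the second
  eigenvalue alone controls the decay.\<close>

lemma ip_P_nonneg: "0 \<le> ip f (P *v f)"
proof -
  have "2 * ip f f \<le> (\<Sum>i\<in>UNIV. \<pi> $ i * P $ i $ i * (f $ i + f $ i)\<^sup>2)"
    unfolding ip_def sum_distrib_left
  proof (rule sum_mono)
    fix i
    have "(\<pi> $ i * (f $ i)\<^sup>2) * 1 \<le> (\<pi> $ i * (f $ i)\<^sup>2) * (2 * P $ i $ i)"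
      using lazy[of i] by (intro mult_left_mono) auto
    then show "2 * (\<pi> $ i * (f $ i * f $ i)) \<le> \<pi> $ i * P $ i $ i * (f $ i + f $ i)\<^sup>2"
      by (simp add: power2_eq_square algebra_simps)
  qed
  also have "\<dots> \<le> (\<Sum>i\<in>UNIV. \<Sum>j\<in>UNIV. \<pi> $ i * P $ i $ j * (f $ i + f $ j)\<^sup>2)"
    by (intro sum_mono member_le_sum) (auto simp: P_nonneg)
  finally show ?thesis using ip_P_plus[of f] by simp
qed

lemma ex_distinct: "\<exists>u v :: 'k. u \<noteq> v"
  using two_states card_le_Suc0_iff_eq[of "UNIV :: 'k set"] by auto

lemma pi_lt_1: "\<pi> $ u < 1"
proof -
  obtain v where "v \<noteq> u" using ex_distinct by metis
  then have "\<pi> $ u + \<pi> $ v \<le> (\<Sum>i\<in>UNIV. \<pi> $ i)"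
    using sum_mono2[of UNIV "{u, v}" "\<lambda>i. \<pi> $ i"] by simp
  then show ?thesis using pi_pos[of v] pi_sum by simp
qed

lemma ex_small_state: "\<exists>u. \<pi> $ u \<le> 1 / 2"
proof (rule ccontr)
  assume "\<nexists>u. \<pi> $ u \<le> 1 / 2"
  then have big: "1 / 2 < \<pi> $ u" for u by (simp add: not_le)
  obtain u v :: 'k where "v \<noteq> u" using ex_distinct by metis
  then have "\<pi> $ u + \<pi> $ v \<le> (\<Sum>i\<in>UNIV. \<pi> $ i)"
    using sum_mono2[of UNIV "{u, v}" "\<lambda>i. \<pi> $ i"] by simp
  then show False using big[of u] big[of v] pi_sum by simp
qed

text \<open>Maximum principle: where \<open>f\<close> is maximal, averaging forces all neighbours to
  be maximal too, so the maximum set is closed under moves.\<close>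

lemma harmonic_imp_constant:
  assumes "P *v f = f"
  shows "\<exists>c. f = c *\<^sub>R 1"
proof -
  define c where "c = Max (range (($) f))"
  have le: "f $ i \<le> c" for i unfolding c_def by simp
  have "{i. f $ i = c} = UNIV"
  proof (rule closed_imp_UNIV)
    have "c \<in> range (($) f)" unfolding c_def by (rule Max_in) auto
    then show "{i. f $ i = c} \<noteq> {}" by auto
    fix i j assume ij: "i \<in> {i. f $ i = c}" "j \<notin> {i. f $ i = c}"
    have "(\<Sum>j\<in>UNIV. P $ i $ j * (c - f $ j)) = c * (\<Sum>j\<in>UNIV. P $ i $ j) - (P *v f) $ i"
      by (simp add: right_diff_distrib sum_subtractf matrix_vector_component sum_distrib_left mult.commute)
    also have "\<dots> = 0" using assms ij by (simp add: P_sum)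
    finally have "\<forall>j\<in>UNIV. P $ i $ j * (c - f $ j) = 0"
      using le by (subst (asm) sum_nonneg_eq_0_iff) (auto simp: P_nonneg)
    then show "P $ i $ j = 0" using ij by force
  qed
  then have "f = c *\<^sub>R 1" by (auto simp: vec_eq_iff)
  then show ?thesis ..
qed

text \<open>The quadratic form of \<open>P\<close> attains its maximum on the compact unit sphere of
  mean-zero functions, and a maximizer is an eigenvector. This gives the variational bound without
  diagonalizing \<open>P\<close>.\<close>

lemma ex_top_eigenvector:
  obtains \<mu> f where "f \<noteq> 0" "mean f = 0" "P *v f = \<mu> *\<^sub>R f"
    "\<And>h. mean h = 0 \<Longrightarrow> ip h (P *v h) \<le> \<mu> * ip h h"
proof -
  define S where "S = {f. mean f = 0 \<and> ip f f = 1}"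
  have cont: "continuous_on UNIV mean" "continuous_on UNIV (\<lambda>f. ip f f)"
      "continuous_on UNIV (\<lambda>f. ip f (P *v f))"
    unfolding mean_def[abs_def] ip_def[abs_def] matrix_vector_component
    by (intro continuous_intros)+
  have "closed S"
  proof -
    have "S = {f. mean f = 0} \<inter> {f. ip f f = 1}" by (auto simp: S_def)
    then show ?thesis
      using cont by (auto intro!: closed_Int closed_Collect_eq continuous_on_const)
  qed
  moreover have "bounded S"
  proof (rule boundedI)
    fix f assume f: "f \<in> S"
    have "\<bar>f $ i\<bar> \<le> 1 / sqrt (\<pi> $ i)" for i
    proof -
      have "\<pi> $ i * (f $ i * f $ i) \<le> ip f f"
        unfolding ip_def by (rule member_le_sum) auto
      then have "(f $ i)\<^sup>2 \<le> 1 / \<pi> $ i"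
        using f pi_pos[of i] by (simp add: S_def field_simps power2_eq_square)
      then show ?thesis
        by (metis real_sqrt_abs real_sqrt_divide real_sqrt_le_iff real_sqrt_one)
    qed
    then have "(\<Sum>i\<in>UNIV. \<bar>f $ i\<bar>) \<le> (\<Sum>i\<in>UNIV. 1 / sqrt (\<pi> $ i))" by (rule sum_mono)
    then show "norm f \<le> (\<Sum>i\<in>UNIV. 1 / sqrt (\<pi> $ i))"
      using norm_le_l1_cart[of f] by linarith
  qed
  ultimately have "compact S" by (simp add: compact_eq_bounded_closed)
  have normalize: "(1 / sqrt (ip h h)) *\<^sub>R h \<in> S" if "mean h = 0" "h \<noteq> 0" for h
    using ip_pos[OF that(2)] that(1) by (simp add: S_def ip_simps field_simps)
  have "S \<noteq> {}"
  proof -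
    obtain u :: 'k where True by simp
    \<comment> \<open>A centred point indicator; it is nonzero because
      \<open>\<pi> $ u < 1\<close>.\<close>
    define h where "h = axis u 1 - (\<pi> $ u) *\<^sub>R (1 :: real ^ 'k)"
    have "mean (axis u 1) = \<pi> $ u" by (simp add: mean_def axis_def if_distrib cong: if_cong)
    then have "mean h = 0" by (simp add: h_def)
    moreover have "h $ u \<noteq> 0" using pi_lt_1[of u] by (simp add: h_def)
    ultimately show ?thesis using normalize[of h] by (metis empty_iff zero_index)
  qed
  moreover have "continuous_on S (\<lambda>f. ip f (P *v f))"
    using cont(3) by (rule continuous_on_subset) simp
  ultimately obtain f where f: "f \<in> S" "\<And>h. h \<in> S \<Longrightarrow> ip h (P *v h) \<le> ip f (P *v f)"
    using continuous_attains_sup[OF \<open>compact S\<close>] by blast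
  define \<mu> where "\<mu> = ip f (P *v f)"
  have mu: "ip h (P *v h) \<le> \<mu> * ip h h" if "mean h = 0" for h
  proof (cases "h = 0")
    case True
    then show ?thesis by (simp add: ip_def)
  next
    case False
    have "ip ((1 / sqrt (ip h h)) *\<^sub>R h) (P *v ((1 / sqrt (ip h h)) *\<^sub>R h)) \<le> \<mu>"
      unfolding \<mu>_def by (rule f(2)[OF normalize[OF that False]])
    then show ?thesis
      using ip_pos[OF False] by (simp add: scaleR_matrix_vector_assoc[symmetric] matrix_vector_mult_scaleR ip_simps field_simps)
  qed
  define h where "h = \<mu> *\<^sub>R f - P *v f"
  have mf: "mean f = 0" "ip f f = 1" using f by (auto simp: S_def)
  have mh: "mean h = 0" by (simp add: h_def mf mean_P)
  define q where "q = \<mu> * ip h h - ip h (P *v h)"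
  text \<open>First-order optimality of \<open>f\<close> in the direction \<open>h\<close>.\<close>
  have quad: "0 \<le> 2 * t * ip h h + t\<^sup>2 * q" for t
  proof -
    have "ip (f + t *\<^sub>R h) (P *v (f + t *\<^sub>R h)) \<le> \<mu> * ip (f + t *\<^sub>R h) (f + t *\<^sub>R h)"
      by (rule mu) (simp add: mf mh)
    moreover have "ip (f + t *\<^sub>R h) (f + t *\<^sub>R h) = 1 + 2 * t * ip f h + t\<^sup>2 * ip h h"
      using ip_commute[of h f] by (simp add: ip_simps mf power2_eq_square algebra_simps)
    moreover have "ip (f + t *\<^sub>R h) (P *v (f + t *\<^sub>R h)) = \<mu> + 2 * t * ip f (P *v h) + t\<^sup>2 * ip h (P *v h)"
      using ip_commute[of h "P *v f"] ip_P_swap[of f h]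
      by (simp add: matrix_vector_right_distrib matrix_vector_mult_scaleR ip_simps
          \<mu>_def[symmetric] power2_eq_square algebra_simps)
    moreover have "ip h h = \<mu> * ip f h - ip f (P *v h)"
      unfolding ip_P_swap[of f h, symmetric] by (subst (1) h_def) (simp add: ip_simps)
    then have "2 * t * ip h h = 2 * t * (\<mu> * ip f h) - 2 * t * ip f (P *v h)"
      by (simp add: right_diff_distrib)
    ultimately show ?thesis by (simp add: q_def algebra_simps)
  qed
  have "h = 0"
  proof (rule ccontr)
    assume "h \<noteq> 0"
    then have pos: "0 < ip h h" by (rule ip_pos)
    have q: "0 \<le> q" unfolding q_def using mu[OF mh] by simp
    \<comment> \<open>Adding 1 avoids division by zero when \<open>q = 0\<close>; at the chosen
      \<open>t\<close> the form in \<open>quad\<close> is still negative.\<close>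
    define Q where "Q = q + 1"
    define t where "t = - ip h h / Q"
    have Q: "0 < Q" "q = Q - 1" using q by (auto simp: Q_def)
    have "2 * t * ip h h + t\<^sup>2 * q = - ((ip h h)\<^sup>2 * (Q + 1) / Q\<^sup>2)"
      using Q(1) unfolding Q(2) by (simp add: t_def field_simps power2_eq_square)
    moreover have "0 < (ip h h)\<^sup>2 * (Q + 1) / Q\<^sup>2" using Q(1) pos by simp
    ultimately have "2 * t * ip h h + t\<^sup>2 * q < 0" by linarith
    then show False using quad[of t] by simp
  qed
  then have "P *v f = \<mu> *\<^sub>R f" by (simp add: h_def)
  moreover have "f \<noteq> 0" using mf by (auto simp: ip_def)
  ultimately show ?thesis using that mf mu by blast
qed

text \<open>Cauchy-Schwarz for the form \<open>ip f (P *v g)\<close>, which is positive semidefinite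
  by laziness, gives \<open>N\<^sup>2 \<le> A * B\<close>. Here \<open>A\<close> and
  \<open>B\<close> are bounded by \<open>\<mu>\<close> times \<open>ip f f\<close> and
  \<open>N\<close>.\<close>

lemma contraction:
  assumes mu: "\<And>h. mean h = 0 \<Longrightarrow> ip h (P *v h) \<le> \<mu> * ip h h" and f: "mean f = 0"
  shows "ip (P *v f) (P *v f) \<le> \<mu>\<^sup>2 * ip f f"
proof (cases "P *v f = 0")
  case True
  moreover have "ip 0 0 = 0" by (simp add: ip_def)
  ultimately show ?thesis by simp
next
  case False
  define g where "g = P *v f"
  define N where "N = ip g g"
  define A where "A = ip f (P *v f)"
  define B where "B = ip g (P *v g)"
  have N: "0 < N" using ip_pos[of g] False by (simp add: N_def g_def)
  have B: "0 \<le> B" "B \<le> \<mu> * N" and A: "A \<le> \<mu> * ip f f"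
    using mu[of g] mu[of f] f ip_P_nonneg by (auto simp: A_def B_def N_def g_def mean_P)
  have quad: "0 \<le> A - 2 * t * N + t\<^sup>2 * B" for t
  proof -
    have "0 \<le> ip (f - t *\<^sub>R g) (P *v (f - t *\<^sub>R g))" by (rule ip_P_nonneg)
    moreover have "ip f (P *v g) = N" "ip g (P *v f) = N"
      using ip_P_swap[of f g] by (auto simp: g_def N_def)
    ultimately show ?thesis
      by (simp add: matrix_vector_mult_diff_distrib matrix_vector_mult_scaleR ip_simps A_def B_def
          power2_eq_square algebra_simps)
  qed
  \<comment> \<open>For \<open>B = 0\<close> the form in \<open>quad\<close> is affine in
    \<open>t\<close> and takes the value -1 at this point. Later \<open>t = N / B\<close> is its
    minimizer.\<close>
  have "B \<noteq> 0"
    using quad[of "(A + 1) / (2 * N)"] N by (auto simp: field_simps)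
  then have "0 < B" using B by simp
  then have "N\<^sup>2 \<le> A * B" using quad[of "N / B"] by (simp add: field_simps power2_eq_square)
  have "0 < \<mu>" using \<open>0 < B\<close> B(2) N by (smt (verit) mult_nonpos_nonneg)
  have "N * N \<le> A * B" using \<open>N\<^sup>2 \<le> A * B\<close> by (simp add: power2_eq_square)
  also have "\<dots> \<le> (\<mu> * ip f f) * (\<mu> * N)"
    using A B \<open>0 < \<mu>\<close> by (intro mult_mono) auto
  finally have "N * N \<le> (\<mu>\<^sup>2 * ip f f) * N" by (simp add: power2_eq_square ac_simps)
  then show ?thesis using N by (simp add: N_def g_def)
qed

section \<open>Eigenvalues and the spectral gap\<close>

lemma eigenspace_orthogonal:
  assumes "f \<in> eigenspace P \<nu>" "g \<in> eigenspace P \<nu>'" "\<nu> \<noteq> \<nu>'"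
  shows "ip f g = 0"
proof -
  have "\<nu> * ip f g = \<nu>' * ip f g"
    using ip_P_swap[of f g] assms by (simp add: eigenspace_def ip_simps)
  then show ?thesis using assms(3) by simp
qed

lemma one_in_eigenspace: "1 \<in> eigenspace P 1"
  by (simp add: eigenspace_def P_one)

lemma mean_eigenvector: "f \<in> eigenspace P \<nu> \<Longrightarrow> \<nu> \<noteq> 1 \<Longrightarrow> mean f = 0"
  unfolding mean_ip using eigenspace_orthogonal[OF one_in_eigenspace] by metis

lemma zero_in_eigenspace [simp]: "0 \<in> eigenspace P \<nu>"
  by (simp add: eigenspace_def)

text \<open>Eigenvectors of distinct eigenvalues are orthogonal, hence independent. Finiteness
  matters because the sum in \<open>eigenvalues\<close> would be the empty multiset over an infinite
  index set.\<close>

lemma finite_eigenvalues: "finite {\<nu>. eigenspace P \<nu> \<noteq> {0}}"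
proof -
  define E where "E = {\<nu>. eigenspace P \<nu> \<noteq> {0}}"
  have "\<exists>f. f \<in> eigenspace P \<nu> \<and> f \<noteq> 0" if "\<nu> \<in> E" for \<nu>
    using that zero_in_eigenspace[of \<nu>] by (auto simp: E_def)
  then obtain F where F: "\<And>\<nu>. \<nu> \<in> E \<Longrightarrow> F \<nu> \<in> eigenspace P \<nu> \<and> F \<nu> \<noteq> 0"
    by metis
  text \<open>Rescaling by \<open>sqrt \<pi>\<close> turns the weighted inner product into the standard one.\<close>
  define G where "G \<nu> = (\<chi> i. sqrt (\<pi> $ i) * F \<nu> $ i)" for \<nu>
  have G: "G \<nu> \<bullet> G \<nu>' = ip (F \<nu>) (F \<nu>')" for \<nu> \<nu>'
    unfolding inner_vec_def ip_def G_def by (intro sum.cong) (auto simp: mult_ac)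
  have nz: "G \<nu> \<noteq> 0" if "\<nu> \<in> E" for \<nu>
    using ip_pos[of "F \<nu>"] F[OF that] G[of \<nu> \<nu>] by auto
  have orth: "G \<nu> \<bullet> G \<nu>' = 0" if "\<nu> \<in> E" "\<nu>' \<in> E" "\<nu> \<noteq> \<nu>'" for \<nu> \<nu>'
    unfolding G using eigenspace_orthogonal F that by blast
  have "inj_on G E"
    using orth nz by (metis inj_onI inner_eq_zero_iff)
  moreover have "independent (G ` E)"
    by (rule pairwise_orthogonal_independent) (use orth nz in \<open>auto simp: pairwise_def orthogonal_def\<close>)
  then have "finite (G ` E)" by (rule independent_imp_finite)
  ultimately show ?thesis unfolding E_def[symmetric] by (rule finite_imageD[rotated])
qed

lemma dim_eigenspace_1: "dim (eigenspace P 1) = 1"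
proof -
  have "eigenspace P 1 = span {1}"
  proof
    show "eigenspace P 1 \<subseteq> span {1}"
      using harmonic_imp_constant by (auto simp: eigenspace_def span_singleton)
    show "span {1} \<subseteq> eigenspace P 1"
      using P_one by (auto simp: eigenspace_def span_singleton matrix_vector_mult_scaleR)
  qed
  then show ?thesis by (simp add: dim_singleton)
qed

lemma eigenvalue_le:
  assumes mu: "\<And>h. mean h = 0 \<Longrightarrow> ip h (P *v h) \<le> \<mu> * ip h h"
    and "eigenspace P \<nu> \<noteq> {0}" "\<nu> \<noteq> 1"
  shows "\<nu> \<le> \<mu>"
proof -
  obtain f where f: "f \<in> eigenspace P \<nu>" "f \<noteq> 0"
    using assms(2) zero_in_eigenspace[of \<nu>] by blast
  then have "\<nu> * ip f f \<le> \<mu> * ip f f"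
    using mu[OF mean_eigenvector[OF f(1) assms(3)]] by (simp add: eigenspace_def ip_simps)
  then show ?thesis using ip_pos[OF f(2)] by simp
qed

text \<open>Nonnegativity of the Dirichlet form gives \<open>\<mu> \<le> 1\<close>. Equality would
  make \<open>f\<close> harmonic, hence constant, and a constant of mean zero vanishes.\<close>

lemma second_eigenvalue_lt_1:
  assumes "f \<noteq> 0" "mean f = 0" "P *v f = \<mu> *\<^sub>R f"
  shows "\<mu> < 1"
proof -
  have "ip f (P *v f) \<le> ip f f"
  proof -
    have "(\<Sum>i\<in>UNIV. \<Sum>j\<in>UNIV. \<pi> $ i * P $ i $ j * (f $ i - f $ j)\<^sup>2)
        = (\<Sum>i\<in>UNIV. \<Sum>j\<in>UNIV. \<pi> $ i * P $ i $ j * (f $ i)\<^sup>2 + \<pi> $ i * P $ i $ j * (f $ j)\<^sup>2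
            - 2 * (\<pi> $ i * P $ i $ j * (f $ i * f $ j)))"
      by (intro sum.cong refl) (simp add: power2_eq_square algebra_simps)
    also have "\<dots> = ip f f + ip f f - 2 * ip f (P *v f)"
      unfolding sum.distrib sum_subtractf diagonal_sums ip_P sum_distrib_left[symmetric] ..
    finally show ?thesis
      using sum_nonneg[of UNIV "\<lambda>i. \<Sum>j\<in>UNIV. \<pi> $ i * P $ i $ j * (f $ i - f $ j)\<^sup>2"]
      by (simp add: sum_nonneg P_nonneg)
  qed
  then have "\<mu> \<le> 1" using ip_pos[OF assms(1)] assms(3) by (simp add: ip_simps)
  moreover have "\<mu> \<noteq> 1"
  proof
    assume "\<mu> = 1"
    then obtain c where c: "f = c *\<^sub>R 1" using harmonic_imp_constant assms(3) by fastforce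
    then have "mean f = c" by simp
    then show False using assms c by simp
  qed
  ultimately show ?thesis by simp
qed

text \<open>The eigenvalue 1 is simple and every other eigenvalue is at most \<open>\<mu>\<close>,
  which itself occurs. So the decreasing list starts with 1 followed by
  \<open>\<mu>\<close>.\<close>

lemma spectral_gap_eq:
  assumes f: "f \<noteq> 0" "mean f = 0" "P *v f = \<mu> *\<^sub>R f"
    and mu: "\<And>h. mean h = 0 \<Longrightarrow> ip h (P *v h) \<le> \<mu> * ip h h"
  shows "spectral_gap P = 1 - \<mu>"
proof -
  define E where "E = {\<nu>. eigenspace P \<nu> \<noteq> {0}}"
  define M where "M = (\<Sum>\<nu>\<in>E. replicate_mset (dim (eigenspace P \<nu>)) \<nu>)"
  define xs where "xs = eigenvalues P"
  have fin: "finite E" using finite_eigenvalues by (simp add: E_def)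
  have mset: "mset xs = M" and sorted: "sorted (rev xs)"
    by (simp_all add: xs_def eigenvalues_def M_def E_def)
  have count: "count M \<nu> = (if \<nu> \<in> E then dim (eigenspace P \<nu>) else 0)" for \<nu>
    unfolding M_def using fin by (simp add: count_sum sum.delta)
  have "\<mu> < 1" by (rule second_eigenvalue_lt_1[OF f])
  have "f \<in> eigenspace P \<mu>" using f by (simp add: eigenspace_def)
  then have "\<mu> \<in> E" "dim (eigenspace P \<mu>) \<noteq> 0"
    using f by (auto simp: E_def dim_eq_0)
  then have muM: "\<mu> \<in># M" by (metis count count_eq_zero_iff)
  have "(1 :: real ^ 'k) \<noteq> 0" by (simp add: vec_eq_iff)
  then have "1 \<in> E" unfolding E_def using one_in_eigenspace by blast
  then have oneM: "count M 1 = 1" by (simp add: count dim_eigenspace_1)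
  have le: "\<nu> \<le> \<mu>" if "\<nu> \<in># M" "\<nu> \<noteq> 1" for \<nu>
  proof -
    have "\<nu> \<in> E" using that(1) count[of \<nu>] by (metis count_eq_zero_iff)
    then show ?thesis using eigenvalue_le[OF mu] that(2) by (simp add: E_def)
  qed
  obtain x ys where xs: "xs = x # ys"
    using muM mset by (cases xs) auto
  have ge: "y \<le> x" if "y \<in> set ys" for y
    using sorted that by (simp add: xs sorted_append)
  have "1 \<in> set xs" using oneM mset by (metis count_eq_zero_iff set_mset_mset zero_neq_one)
  then have "1 \<le> x" using ge by (auto simp: xs)
  moreover have "x \<in># M" using mset by (auto simp: xs)
  ultimately have "x = 1" using le \<open>\<mu> < 1\<close> by fastforce
  have M: "M = add_mset 1 (mset ys)" using mset by (simp add: xs \<open>x = 1\<close>)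
  then have "\<mu> \<in> set ys" using muM \<open>\<mu> < 1\<close> by simp
  have "1 \<notin> set ys" using oneM by (simp add: M count_eq_zero_iff)
  then have le_mu: "y \<le> \<mu>" if "y \<in> set ys" for y using that le[of y] by (auto simp: M)
  obtain y zs where ys: "ys = y # zs" using \<open>\<mu> \<in> set ys\<close> by (cases ys) auto
  have "z \<le> y" if "z \<in> set zs" for z
    using sorted that by (simp add: xs ys sorted_append)
  then have "\<mu> \<le> y" using \<open>\<mu> \<in> set ys\<close> by (auto simp: ys)
  then have "y = \<mu>" using le_mu[of y] by (simp add: ys)
  then show ?thesis unfolding spectral_gap_def xs_def[symmetric] by (simp add: xs ys)
qed

text \<open>For the centred indicator of \<open>A\<close> the squared norm is
  \<open>a - a * a\<close>, and the quadratic form of \<open>P\<close> is smaller by exactly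
  \<open>cut_flow A\<close>.\<close>

lemma gap_le_cut_flow:
  assumes mu: "\<And>h. mean h = 0 \<Longrightarrow> ip h (P *v h) \<le> \<mu> * ip h h"
  shows "(1 - \<mu>) * (set_prob \<pi> A * (1 - set_prob \<pi> A)) \<le> cut_flow A"
proof -
  define a where "a = set_prob \<pi> A"
  define u :: "real ^ 'k" where "u = (\<chi> i. if i \<in> A then 1 else 0)"
  have u: "u $ i = (if i \<in> A then 1 else 0)" for i by (simp add: u_def)
  define h where "h = u - a *\<^sub>R 1"
  have restrict: "(\<Sum>i\<in>UNIV. if i \<in> A then c i else 0) = sum c A" for c :: "'k \<Rightarrow> real"
    by (simp add: sum.If_cases)
  have "mean u = (\<Sum>i\<in>UNIV. if i \<in> A then \<pi> $ i else 0)"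
    unfolding mean_def by (intro sum.cong) (auto simp: u)
  then have mean_u: "mean u = a" by (simp add: restrict a_def set_prob_def)
  have "ip u u = (\<Sum>i\<in>UNIV. if i \<in> A then \<pi> $ i else 0)"
    unfolding ip_def by (intro sum.cong) (auto simp: u)
  then have u_u: "ip u u = a" by (simp add: restrict a_def set_prob_def)
  have Pu: "(P *v u) $ i = 1 - escape A i" for i
  proof -
    have "(P *v u) $ i = (\<Sum>j\<in>UNIV. if j \<in> A then P $ i $ j else 0)"
      unfolding matrix_vector_component by (intro sum.cong) (auto simp: u)
    then show ?thesis by (simp add: restrict sum_P_in)
  qed
  have "ip u (P *v u) = (\<Sum>i\<in>UNIV. if i \<in> A then \<pi> $ i * (1 - escape A i) else 0)"
    unfolding ip_def by (intro sum.cong) (auto simp: u Pu)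
  then have u_Pu: "ip u (P *v u) = a - cut_flow A"
    by (simp add: restrict a_def set_prob_def cut_flow_def right_diff_distrib sum_subtractf)
  have one: "ip 1 u = a" "ip u 1 = a" "ip 1 (P *v u) = a" "ip 1 1 = 1"
    using mean_u mean_P[of u] mean_simps(4) ip_commute[of 1 u] by (simp_all add: mean_ip)
  have "mean h = 0" by (simp add: h_def mean_u)
  then have "ip h (P *v h) \<le> \<mu> * ip h h" by (rule mu)
  moreover have "ip h (P *v h) = a - cut_flow A - a * a"
    by (simp add: h_def ip_simps matrix_vector_mult_diff_distrib matrix_vector_mult_scaleR P_one one u_Pu)
  moreover have "ip h h = a - a * a"
    by (simp add: h_def ip_simps one u_u)
  ultimately show ?thesis unfolding a_def[symmetric] by (simp add: algebra_simps)
qed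

lemma second_eigenvalue_le:
  assumes f: "f \<noteq> 0" "mean f = 0" "P *v f = \<mu> *\<^sub>R f"
    and c: "\<And>A. A \<noteq> {} \<Longrightarrow> set_prob \<pi> A \<le> 1 / 2 \<Longrightarrow> c \<le> min_flow A / (8 * (set_prob \<pi> A)\<^sup>2)"
  shows "\<mu> \<le> 1 - c"
proof -
  have half: "\<mu> \<le> 1 - c"
    if h: "h \<noteq> 0" "mean h = 0" "P *v h = \<mu> *\<^sub>R h" "set_prob \<pi> {x. 0 < h $ x} \<le> 1 / 2" for h
  proof (rule truncated_eigenvalue_bound[OF _ _ _ _ c])
    define g where "g x = max (h $ x) 0" for x
    show "0 \<le> g x" for x by (simp add: g_def)
    show "\<exists>x. 0 < g x"
    proof (rule ccontr)
      assume "\<nexists>x. 0 < g x"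
      then have le: "h $ x \<le> 0" for x by (auto simp: g_def less_max_iff_disj not_less)
      have "(\<Sum>i\<in>UNIV. \<pi> $ i * - h $ i) = 0" using h(2) by (simp add: mean_def sum_negf)
      then have "\<forall>i\<in>UNIV. \<pi> $ i * - h $ i = 0"
        by (subst (asm) sum_nonneg_eq_0_iff) (auto intro!: mult_nonneg_nonpos simp: le)
      then have "h $ i = 0" for i using pi_pos[of i] by (metis UNIV_I less_irrefl mult_eq_0_iff neg_equal_0_iff_equal)
      then show False using h(1) by (simp add: vec_eq_iff)
    qed
    \<comment> \<open>Where \<open>h\<close> is positive, \<open>P\<close> applied to
      \<open>g\<close> dominates \<open>P\<close> applied to \<open>h\<close>; elsewhere the left
      side is zero.\<close>
    show "\<mu> * g x \<le> (\<Sum>y\<in>UNIV. P $ x $ y * g y)" for x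
    proof (cases "0 < h $ x")
      case True
      have "\<mu> * g x = (P *v h) $ x" using True by (simp add: h(3) g_def)
      also have "\<dots> \<le> (\<Sum>y\<in>UNIV. P $ x $ y * g y)"
        unfolding matrix_vector_component by (intro sum_mono mult_left_mono) (auto simp: g_def P_nonneg)
      finally show ?thesis .
    next
      case False
      then have "g x = 0" by (simp add: g_def)
      then show ?thesis by (simp add: sum_nonneg P_nonneg g_def)
    qed
    show "set_prob \<pi> {x. 0 < g x} \<le> 1 / 2" using h(4) by (simp add: g_def less_max_iff_disj)
  qed
  show ?thesis
  proof (cases "set_prob \<pi> {x. 0 < f $ x} \<le> 1 / 2")
    case True
    then show ?thesis using half f by blast
  next
    case False
    have "set_prob \<pi> {x. 0 < (- f) $ x} \<le> set_prob \<pi> (- {x. 0 < f $ x})"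
      unfolding set_prob_def by (intro sum_mono2) auto
    then have "set_prob \<pi> {x. 0 < (- f) $ x} \<le> 1 / 2"
      using False by (simp add: set_prob_Compl)
    moreover have "P *v (- f) = \<mu> *\<^sub>R (- f)"
      using f(3) by (simp add: vec_eq_iff matrix_vector_component sum_negf)
    moreover have "mean (- f) = 0" using f(2) by (simp add: mean_def sum_negf)
    ultimately show ?thesis using half[of "- f"] f(1) by simp
  qed
qed

section \<open>Densities relative to \<open>\<pi>\<close> and the mixing time\<close>

definition density :: "real ^ 'k \<Rightarrow> real ^ 'k" where
  "density p = (\<chi> i. p $ i / \<pi> $ i - 1)"

lemma mat_power_simps: "mat_power P 0 = mat 1" "mat_power P (Suc t) = P ** mat_power P t"
  by (simp_all add: mat_power_def)

text \<open>Reversibility turns the action on distributions from the right into the action on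
  functions from the left.\<close>

lemma density_step: "density (p v* P) = P *v density p"
proof -
  have "(\<Sum>i\<in>UNIV. p $ i * P $ i $ j) / \<pi> $ j = (\<Sum>i\<in>UNIV. P $ j $ i * (p $ i / \<pi> $ i))" for j
    unfolding sum_divide_distrib
  proof (rule sum.cong)
    fix i
    have "P $ i $ j / \<pi> $ j = P $ j $ i / \<pi> $ i"
      using rev[of i j] pi_pos[of i] pi_pos[of j] by (simp add: field_simps)
    then show "p $ i * P $ i $ j / \<pi> $ j = P $ j $ i * (p $ i / \<pi> $ i)"
      by (metis mult.commute times_divide_eq_left times_divide_eq_right)
  qed simp
  then show ?thesis
    by (simp add: vec_eq_iff density_def vector_matrix_mult_def matrix_vector_component
        right_diff_distrib sum_subtractf P_sum)
qed

lemma mean_density: "prob_vec p \<Longrightarrow> mean (density p) = 0"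
  using pi_pos by (simp add: mean_def density_def prob_vec_def right_diff_distrib sum_subtractf pi_sum less_imp_neq[symmetric])

text \<open>Since \<open>mat_power\<close> multiplies on the left, the induction peels off the first
  step of the chain and has to generalize over \<open>p\<close>.\<close>

lemma ip_density_mat_power:
  assumes mu: "\<And>h. mean h = 0 \<Longrightarrow> ip h (P *v h) \<le> \<mu> * ip h h" and "mean (density p) = 0"
  shows "ip (density (p v* mat_power P t)) (density (p v* mat_power P t)) \<le> (\<mu> ^ t)\<^sup>2 * ip (density p) (density p)"
  using assms(2)
proof (induction t arbitrary: p)
  case 0
  then show ?case by (simp add: mat_power_simps)
next
  case (Suc t)
  have "ip (density ((p v* P) v* mat_power P t)) (density ((p v* P) v* mat_power P t))
      \<le> (\<mu> ^ t)\<^sup>2 * ip (density (p v* P)) (density (p v* P))"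
    by (rule Suc.IH) (simp add: density_step mean_P Suc.prems)
  also have "\<dots> \<le> (\<mu> ^ t)\<^sup>2 * (\<mu>\<^sup>2 * ip (density p) (density p))"
    unfolding density_step by (intro mult_left_mono contraction mu Suc.prems) auto
  finally show ?case
    by (simp add: mat_power_simps vector_matrix_mul_assoc power_mult_distrib mult_ac)
qed

text \<open>Twice the total variation distance is the mean \<open>m\<close> of the absolute density,
  and the variance of the absolute density is nonnegative.\<close>

lemma tv_dist_density: "tv_dist p \<pi> \<le> 1 / 2 * sqrt (ip (density p) (density p))"
proof -
  define m where "m = (\<Sum>i\<in>UNIV. \<pi> $ i * \<bar>density p $ i\<bar>)"
  have "(\<Sum>i\<in>UNIV. \<bar>p $ i - \<pi> $ i\<bar>) = m"
    unfolding m_def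
  proof (rule sum.cong)
    fix i
    have "p $ i - \<pi> $ i = \<pi> $ i * density p $ i"
      using pi_pos[of i] by (simp add: density_def right_diff_distrib)
    then show "\<bar>p $ i - \<pi> $ i\<bar> = \<pi> $ i * \<bar>density p $ i\<bar>" by (simp add: abs_mult)
  qed simp
  have "0 \<le> (\<Sum>i\<in>UNIV. \<pi> $ i * (\<bar>density p $ i\<bar> - m)\<^sup>2)"
    by (simp add: sum_nonneg)
  also have "\<dots> = (\<Sum>i\<in>UNIV. \<pi> $ i * (density p $ i * density p $ i) - 2 * m * (\<pi> $ i * \<bar>density p $ i\<bar>)
      + m\<^sup>2 * \<pi> $ i)"
    by (intro sum.cong) (auto simp: power2_eq_square algebra_simps abs_mult_self_eq)
  also have "\<dots> = ip (density p) (density p) - m\<^sup>2"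
    unfolding sum.distrib sum_subtractf sum_distrib_left[symmetric] pi_sum m_def[symmetric]
    by (simp add: ip_def power2_eq_square)
  finally have "m \<le> sqrt (ip (density p) (density p))" by (intro real_le_rsqrt) simp
  then show ?thesis by (simp add: tv_dist_def \<open>_ = m\<close>)
qed

text \<open>The left side is the chi-square distance,
  \<open>\<Sum>i\<in>UNIV. p $ i * p $ i / \<pi> $ i\<close> minus 1; one factor
  \<open>p $ i\<close> is bounded by 1.\<close>

lemma ip_density_le:
  assumes p: "prob_vec p" and pi0: "0 < \<pi>0" "\<And>i. \<pi>0 \<le> \<pi> $ i"
  shows "ip (density p) (density p) \<le> 1 / \<pi>0 - 1"
proof -
  have p_le: "p $ i \<le> 1" for i
    using member_le_sum[of i UNIV "\<lambda>i. p $ i"] p by (simp add: prob_vec_def)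
  have "ip (density p) (density p) = (\<Sum>i\<in>UNIV. p $ i * p $ i / \<pi> $ i - 2 * p $ i + \<pi> $ i)"
    unfolding ip_def
  proof (rule sum.cong)
    fix i
    show "\<pi> $ i * (density p $ i * density p $ i) = p $ i * p $ i / \<pi> $ i - 2 * p $ i + \<pi> $ i"
      using pi_pos[of i] by (simp add: density_def field_simps)
  qed simp
  also have "\<dots> = (\<Sum>i\<in>UNIV. p $ i * p $ i / \<pi> $ i) - 1"
    using p unfolding sum.distrib sum_subtractf sum_distrib_left[symmetric] pi_sum by (simp add: prob_vec_def)
  also have "(\<Sum>i\<in>UNIV. p $ i * p $ i / \<pi> $ i) \<le> (\<Sum>i\<in>UNIV. p $ i * 1 / \<pi>0)"
    using p p_le pi0 pi_pos by (intro sum_mono frac_le mult_left_mono) (auto simp: prob_vec_def)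
  also have "\<dots> = 1 / \<pi>0"
    using p by (simp add: prob_vec_def sum_divide_distrib[symmetric])
  finally show ?thesis by simp
qed

lemma tv_dist_mat_power_le:
  assumes mu: "\<And>h. mean h = 0 \<Longrightarrow> ip h (P *v h) \<le> \<mu> * ip h h" "0 \<le> \<mu>"
    and p: "prob_vec p" and pi0: "0 < \<pi>0" "\<And>i. \<pi>0 \<le> \<pi> $ i"
  shows "tv_dist (p v* mat_power P t) \<pi> \<le> 1 / 2 * (\<mu> ^ t * sqrt (1 / \<pi>0 - 1))"
proof -
  have "ip (density (p v* mat_power P t)) (density (p v* mat_power P t))
      \<le> (\<mu> ^ t)\<^sup>2 * ip (density p) (density p)"
    by (intro ip_density_mat_power mu mean_density p)
  also have "\<dots> \<le> (\<mu> ^ t)\<^sup>2 * (1 / \<pi>0 - 1)"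
    by (intro mult_left_mono ip_density_le p pi0) auto
  finally have "sqrt (ip (density (p v* mat_power P t)) (density (p v* mat_power P t)))
      \<le> sqrt ((\<mu> ^ t)\<^sup>2 * (1 / \<pi>0 - 1))" by simp
  also have "\<dots> = \<mu> ^ t * sqrt (1 / \<pi>0 - 1)"
    using mu(2) by (simp add: real_sqrt_mult)
  finally show ?thesis using tv_dist_density[of "p v* mat_power P t"] by linarith
qed

text \<open>There are infinitely many initial distributions, so the common bound \<open>N\<close> is
  also what makes the set under \<open>Max\<close> finite.\<close>

lemma mixing_time_le:
  assumes "\<And>p. prob_vec p \<Longrightarrow> tv_dist (p v* mat_power P N) \<pi> \<le> \<epsilon>"
  shows "mixing_time P \<pi> \<epsilon> \<le> N"
proof -
  define L where "L p = (LEAST t. tv_dist (p v* mat_power P t) \<pi> \<le> \<epsilon>)" for p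
  have le: "L p \<le> N" if "prob_vec p" for p
    unfolding L_def using assms[OF that] by (rule Least_le)
  have "L ` {p. prob_vec p} \<subseteq> {..N}" using le by auto
  then have "finite (L ` {p. prob_vec p})" by (rule finite_subset) simp
  moreover have "prob_vec \<pi>" by (simp add: prob_vec_def pi_sum)
  ultimately show ?thesis
    unfolding mixing_time_def L_def[symmetric, abs_def] using le by (subst Max_le_iff) auto
qed

lemma mat_power_eigenvector:
  assumes "P *v f = \<mu> *\<^sub>R f"
  shows "mat_power P t *v f = (\<mu> ^ t) *\<^sub>R f"
  by (induction t)
    (simp_all add: mat_power_simps matrix_vector_mul_assoc[symmetric] matrix_vector_mult_scaleR assms mult.commute)

text \<open>Start at a state \<open>x\<close> where the absolute value of \<open>f\<close> is
  maximal. After \<open>t\<close> steps \<open>f\<close> has expectation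
  \<open>\<mu> ^ t * f $ x\<close>, while its mean under \<open>\<pi>\<close> is zero, so total
  variation controls \<open>\<mu> ^ t\<close>. The bound at \<open>N\<close> makes
  \<open>LEAST\<close> and \<open>Max\<close> meaningful.\<close>

lemma mixing_time_ge:
  assumes f: "f \<noteq> 0" "mean f = 0" "P *v f = \<mu> *\<^sub>R f" and "0 \<le> \<mu>"
    and bound: "\<And>p. prob_vec p \<Longrightarrow> tv_dist (p v* mat_power P N) \<pi> \<le> \<epsilon>"
  shows "\<mu> ^ mixing_time P \<pi> \<epsilon> \<le> 2 * \<epsilon>"
proof -
  define L where "L p = (LEAST t. tv_dist (p v* mat_power P t) \<pi> \<le> \<epsilon>)" for p
  define F where "F = Max (range (\<lambda>i. \<bar>f $ i\<bar>))"
  have F_ge: "\<bar>f $ i\<bar> \<le> F" for i unfolding F_def by simp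
  have "F \<in> range (\<lambda>i. \<bar>f $ i\<bar>)" unfolding F_def by (rule Max_in) auto
  then obtain x where x: "\<bar>f $ x\<bar> = F" by auto
  obtain i where "f $ i \<noteq> 0" using f(1) by (auto simp: vec_eq_iff)
  then have "0 < F" using F_ge[of i] by linarith
  define p :: "real ^ 'k" where "p = axis x 1"
  have p: "prob_vec p" by (simp add: prob_vec_def p_def axis_def)
  define t where "t = L p"
  have tv: "tv_dist (p v* mat_power P t) \<pi> \<le> \<epsilon>"
    unfolding t_def L_def using bound[OF p] by (rule LeastI)
  have swap: "(\<Sum>j\<in>UNIV. (p v* mat_power P t) $ j * f $ j) = (\<Sum>i\<in>UNIV. p $ i * (mat_power P t *v f) $ i)"
    unfolding vector_matrix_mult_def matrix_vector_mult_def
    by (simp add: sum_distrib_left sum_distrib_right) (subst sum.swap, simp add: mult_ac)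
  have "(\<Sum>j\<in>UNIV. (p v* mat_power P t) $ j * f $ j) = \<mu> ^ t * f $ x"
    unfolding swap mat_power_eigenvector[OF f(3)] by (simp add: p_def axis_def if_distrib[where f = "\<lambda>c. c * _"] cong: if_cong)
  then have "\<mu> ^ t * f $ x = (\<Sum>j\<in>UNIV. ((p v* mat_power P t) $ j - \<pi> $ j) * f $ j)"
    using f(2) by (simp add: left_diff_distrib sum_subtractf mean_def)
  also have "\<bar>\<dots>\<bar> \<le> (\<Sum>j\<in>UNIV. \<bar>(p v* mat_power P t) $ j - \<pi> $ j\<bar> * F)"
    by (rule order_trans[OF sum_abs]) (auto simp: abs_mult intro!: sum_mono mult_left_mono F_ge)
  also have "\<dots> = 2 * tv_dist (p v* mat_power P t) \<pi> * F"
    by (simp add: tv_dist_def sum_distrib_right)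
  also have "\<dots> \<le> 2 * \<epsilon> * F" using tv \<open>0 < F\<close> by simp
  finally have "\<mu> ^ t * F \<le> 2 * \<epsilon> * F" using \<open>0 \<le> \<mu>\<close> x by (simp add: abs_mult)
  then have le: "\<mu> ^ t \<le> 2 * \<epsilon>" using \<open>0 < F\<close> by simp
  have "L q \<le> N" if "prob_vec q" for q
    unfolding L_def using bound[OF that] by (rule Least_le)
  then have "L ` {p. prob_vec p} \<subseteq> {..N}" by auto
  then have "finite (L ` {p. prob_vec p})" by (rule finite_subset) simp
  then have "t \<le> mixing_time P \<pi> \<epsilon>"
    unfolding mixing_time_def L_def[symmetric, abs_def] t_def using p by (intro Max_ge) auto
  moreover have "\<mu> \<le> 1" using second_eigenvalue_lt_1[OF f(1-3)] by simp
  ultimately show ?thesis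
    using le power_decreasing[of t "mixing_time P \<pi> \<epsilon>" \<mu>] \<open>0 \<le> \<mu>\<close> by simp
qed

end

subsection \<open>The continuized chain\<close>

locale continuized_chain = positive_reversible_chain P \<pi>
  for P :: "real ^ 'k::finite ^ 'k" and \<pi> :: "real ^ 'k" +
  fixes I :: "'k \<Rightarrow> real set"
  assumes partition: "interval_partition \<pi> I"
begin

text \<open>The flow out of a set \<open>B\<close> depends only on the masses that \<open>B\<close>
  has in the intervals, so such mass vectors replace the sets \<open>B\<close>. Values outside
  \<open>A\<close> are left free.\<close>

definition alloc :: "'k set \<Rightarrow> real \<Rightarrow> ('k \<Rightarrow> real) set" where
  "alloc A t = {\<beta>. (\<forall>x\<in>A. 0 \<le> \<beta> x \<and> \<beta> x \<le> \<pi> $ x) \<and> sum \<beta> A = t}"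

definition alloc_flow :: "'k set \<Rightarrow> ('k \<Rightarrow> real) \<Rightarrow> real" where
  "alloc_flow A \<beta> = (\<Sum>x\<in>A. \<beta> x * escape A x)"

section \<open>From measurable sets to allocations of mass\<close>

lemma I_interval: "is_interval (I v)" and I_subset: "I v \<subseteq> {0..1}"
  and measure_I: "measure lebesgue (I v) = \<pi> $ v"
  and negligible_I: "u \<noteq> v \<Longrightarrow> negligible (I u \<inter> I v)"
  using partition by (auto simp: interval_partition_def)

lemma I_lmeasurable: "I v \<in> lmeasurable"
  using I_interval I_subset
  by (intro measurable_convex) (auto simp: is_interval_convex_1 intro: bounded_subset[OF bounded_closed_interval])

lemma measure_subset_disjoint:
  assumes "B \<subseteq> continuize I A" "x \<notin> A"
  shows "measure lebesgue (B \<inter> I x) = 0"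
proof -
  have "negligible (\<Union>z\<in>A. I z \<inter> I x)"
    using assms(2) by (intro negligible_Union) (auto intro: negligible_I)
  then have "negligible (B \<inter> I x)"
    by (rule negligible_subset) (use assms(1) in \<open>auto simp: continuize_def\<close>)
  then show ?thesis by (rule negligible_imp_measure0)
qed

lemma measure_continuize_Int:
  "measure lebesgue (continuize I A \<inter> I x) = (if x \<in> A then \<pi> $ x else 0)"
proof (cases "x \<in> A")
  case True
  then have "continuize I A \<inter> I x = I x" by (auto simp: continuize_def)
  then show ?thesis using True measure_I by simp
next
  case False
  then show ?thesis using measure_subset_disjoint[of "continuize I A" A x] by simp
qed

lemma measure_Int_I_le:
  assumes "B \<in> sets lebesgue"
  shows "measure lebesgue (B \<inter> I x) \<le> \<pi> $ x"
  unfolding measure_I[symmetric]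
  using assms I_lmeasurable[of x] by (intro measure_mono_fmeasurable) (auto dest: fmeasurableD)

lemma sum_measure_Int_I:
  assumes "B \<in> sets lebesgue" "B \<subseteq> continuize I A"
  shows "(\<Sum>x\<in>A. measure lebesgue (B \<inter> I x)) = measure lebesgue B"
proof -
  have "measure lebesgue (\<Union>((\<lambda>x. B \<inter> I x) ` A)) = (\<Sum>x\<in>A. measure lebesgue (B \<inter> I x))"
  proof (rule measure_negligible_finite_Union_image)
    show "B \<inter> I x \<in> lmeasurable" for x
      by (rule fmeasurableI2[OF I_lmeasurable[of x]]) (use assms(1) I_lmeasurable[of x] in \<open>auto dest: fmeasurableD\<close>)
    show "pairwise (\<lambda>x y. negligible ((B \<inter> I x) \<inter> (B \<inter> I y))) A"
      unfolding pairwise_def by (intro ballI impI negligible_subset[OF negligible_I]) auto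
  qed simp
  moreover have "\<Union>((\<lambda>x. B \<inter> I x) ` A) = B" using assms(2) by (auto simp: continuize_def)
  ultimately show ?thesis by simp
qed

lemma flow_eq_alloc_flow:
  assumes "B \<subseteq> continuize I A"
  shows "flow P \<pi> I B (continuize I (- A)) = alloc_flow A (\<lambda>x. measure lebesgue (B \<inter> I x))"
proof -
  have summand: "measure lebesgue (B \<inter> I x) / \<pi> $ x
        * (measure lebesgue (continuize I (- A) \<inter> I y) / \<pi> $ y) * ergodic_flow P \<pi> x y
      = (if x \<in> A then if y \<in> - A then measure lebesgue (B \<inter> I x) * P $ x $ y else 0 else 0)" for x y
    using pi_pos[of x] pi_pos[of y]
    by (simp add: measure_continuize_Int ergodic_flow_def measure_subset_disjoint[OF assms])
  have "(\<Sum>y\<in>UNIV. if x \<in> A then if y \<in> - A then c y else 0 else 0) = (if x \<in> A then sum c (- A) else 0)"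
    for x and c :: "'k \<Rightarrow> real"
    by (cases "x \<in> A") (simp_all add: sum.If_cases Compl_eq)
  then show ?thesis
    unfolding flow_def summand alloc_flow_def escape_def
    by (simp add: sum.If_cases sum_distrib_left)
qed

lemma alloc_of_subset:
  assumes "B \<in> subsets_of_measure I A t"
  shows "(\<lambda>x. measure lebesgue (B \<inter> I x)) \<in> alloc A t"
  using assms measure_Int_I_le sum_measure_Int_I
  by (auto simp: subsets_of_measure_def alloc_def)

text \<open>The endpoints of \<open>I x\<close> may or may not belong to it, so room for a piece of
  prescribed length is found in the interior.\<close>

lemma I_contains_open_interval: "\<exists>l. {l<..<l + \<pi> $ x} \<subseteq> I x"
proof -
  have ne: "I x \<noteq> {}" using measure_I[of x] pi_pos[of x] by force
  have bdd: "bdd_below (I x)" "bdd_above (I x)"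
    using I_subset[of x] by (auto intro: bdd_below_mono bdd_above_mono)
  define l u where "l = Inf (I x)" and "u = Sup (I x)"
  have sub: "I x \<subseteq> {l..u}"
    using bdd by (auto simp: l_def u_def intro: cInf_lower cSup_upper)
  then have "l \<le> u" using ne by fastforce
  have "\<pi> $ x \<le> measure lebesgue {l..u}"
    unfolding measure_I[symmetric] using I_lmeasurable[of x] sub
    by (intro measure_mono_fmeasurable) (auto dest: fmeasurableD)
  then have "\<pi> $ x \<le> u - l" using \<open>l \<le> u\<close> by simp
  moreover have "{l<..<u} \<subseteq> I x"
  proof
    fix y assume y: "y \<in> {l<..<u}"
    then obtain a b where "a \<in> I x" "a < y" "b \<in> I x" "y < b"
      using ne bdd by (auto simp: l_def u_def cInf_less_iff less_cSup_iff)
    then show "y \<in> I x" using I_interval[of x] by (auto intro: mem_is_interval_1_I[of _ a b])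
  qed
  ultimately show ?thesis by (intro exI[of _ l]) auto
qed

text \<open>Cut an initial piece of length \<open>\<beta> x\<close> from each interval. The
  intervals overlap only in null sets, so the pieces do not disturb each other's measure.\<close>

lemma subset_of_alloc:
  assumes "\<beta> \<in> alloc A t"
  shows "\<exists>B\<in>subsets_of_measure I A t. \<forall>x\<in>A. measure lebesgue (B \<inter> I x) = \<beta> x"
proof -
  obtain l where l: "\<And>x. {l x<..<l x + \<pi> $ x} \<subseteq> I x"
    using I_contains_open_interval by metis
  define J where "J x = {l x<..<l x + \<beta> x}" for x
  have \<beta>: "0 \<le> \<beta> x" "\<beta> x \<le> \<pi> $ x" if "x \<in> A" for x
    using assms that by (auto simp: alloc_def)
  have JI: "J x \<subseteq> I x" if "x \<in> A" for x
    using l[of x] \<beta>[OF that] by (auto simp: J_def)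
  have mJ: "measure lebesgue (J x) = \<beta> x" if "x \<in> A" for x
    using \<beta>[OF that] by (simp add: J_def)
  define B where "B = (\<Union>x\<in>A. J x)"
  have B: "B \<in> sets lebesgue" "B \<subseteq> continuize I A"
    using JI by (auto simp: B_def J_def continuize_def)
  have BI: "measure lebesgue (B \<inter> I x) = \<beta> x" if x: "x \<in> A" for x
  proof -
    have "measure lebesgue (B \<inter> I x) = measure lebesgue (J x)"
    proof (rule measure_negligible_symdiff)
      show "J x \<in> lmeasurable" unfolding J_def by (metis box_real(1) lmeasurable_box)
      have "negligible (\<Union>z\<in>-{x}. I z \<inter> I x)"
        by (intro negligible_Union) (auto intro: negligible_I)
      then show "negligible (J x - B \<inter> I x \<union> (B \<inter> I x - J x))"
        by (rule negligible_subset) (use JI x in \<open>unfold B_def, blast\<close>)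
    qed
    then show ?thesis using mJ[OF x] by simp
  qed
  have "measure lebesgue B = t"
    using sum_measure_Int_I[OF B] BI assms by (simp add: alloc_def)
  then have "B \<in> subsets_of_measure I A t" using B by (simp add: subsets_of_measure_def)
  then show ?thesis using BI by blast
qed

lemma flow_image:
  "(\<lambda>B. flow P \<pi> I B (continuize I (- A))) ` subsets_of_measure I A t = alloc_flow A ` alloc A t"
proof (intro equalityI subsetI)
  fix r assume "r \<in> (\<lambda>B. flow P \<pi> I B (continuize I (- A))) ` subsets_of_measure I A t"
  then show "r \<in> alloc_flow A ` alloc A t"
    using alloc_of_subset flow_eq_alloc_flow by (force simp: subsets_of_measure_def)
next
  fix r assume "r \<in> alloc_flow A ` alloc A t"
  then obtain \<beta> where \<beta>: "\<beta> \<in> alloc A t" "r = alloc_flow A \<beta>" by blast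
  obtain B where B: "B \<in> subsets_of_measure I A t" "\<forall>x\<in>A. measure lebesgue (B \<inter> I x) = \<beta> x"
    using subset_of_alloc[OF \<beta>(1)] by blast
  have "flow P \<pi> I B (continuize I (- A)) = r"
    using B by (simp add: flow_eq_alloc_flow subsets_of_measure_def \<beta>(2) alloc_flow_def)
  then show "r \<in> (\<lambda>B. flow P \<pi> I B (continuize I (- A))) ` subsets_of_measure I A t"
    using B(1) by blast
qed

lemma Psi_alloc: "Psi P \<pi> I t A = Inf (alloc_flow A ` alloc A t)"
  and Psi_big_alloc: "Psi_big P \<pi> I t A = Sup (alloc_flow A ` alloc A t)"
  unfolding Psi_def Psi_big_def flow_image by simp_all

text \<open>The last bound holds because an allocation misses only the mass
  \<open>set_prob \<pi> A - t\<close> of \<open>A\<close>, and the escape probability is at most 1.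
  It keeps \<open>Psi\<close> positive for \<open>t\<close> near
  \<open>set_prob \<pi> A\<close>.\<close>

lemma alloc_flow_bounds:
  assumes "\<beta> \<in> alloc A t"
  shows "0 \<le> alloc_flow A \<beta>" "alloc_flow A \<beta> \<le> t" "alloc_flow A \<beta> \<ge> cut_flow A - (set_prob \<pi> A - t)"
proof -
  have \<beta>: "0 \<le> \<beta> x" "\<beta> x \<le> \<pi> $ x" if "x \<in> A" for x
    using assms that by (auto simp: alloc_def)
  have t: "sum \<beta> A = t" using assms by (simp add: alloc_def)
  show "0 \<le> alloc_flow A \<beta>" unfolding alloc_flow_def by (intro sum_nonneg mult_nonneg_nonneg \<beta>) auto
  have "alloc_flow A \<beta> \<le> sum \<beta> A"
    unfolding alloc_flow_def
    by (intro sum_mono mult_left_le) (auto simp: escape_le_1 \<beta>)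
  then show "alloc_flow A \<beta> \<le> t" using t by simp
  have "(\<Sum>x\<in>A. (\<pi> $ x - \<beta> x) * escape A x) \<le> (\<Sum>x\<in>A. \<pi> $ x - \<beta> x)"
    by (intro sum_mono mult_left_le) (auto simp: escape_le_1 \<beta>)
  then show "alloc_flow A \<beta> \<ge> cut_flow A - (set_prob \<pi> A - t)"
    using t by (simp add: left_diff_distrib sum_subtractf cut_flow_def alloc_flow_def set_prob_def)
qed

lemma bdd_alloc_flow: "bdd_below (alloc_flow A ` alloc A t)" "bdd_above (alloc_flow A ` alloc A t)"
  using alloc_flow_bounds by (auto intro!: bdd_belowI[of _ 0] bdd_aboveI[of _ t])

lemma Psi_le: "\<beta> \<in> alloc A t \<Longrightarrow> Psi P \<pi> I t A \<le> alloc_flow A \<beta>"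
  unfolding Psi_alloc by (rule cInf_lower[OF imageI bdd_alloc_flow(1)])

lemma Psi_big_ge: "\<beta> \<in> alloc A t \<Longrightarrow> alloc_flow A \<beta> \<le> Psi_big P \<pi> I t A"
  unfolding Psi_big_alloc by (rule cSup_upper[OF imageI bdd_alloc_flow(2)])

lemma proportional_alloc:
  assumes "0 \<le> t" "t \<le> set_prob \<pi> A" "A \<noteq> {}"
  shows "(\<lambda>x. t / set_prob \<pi> A * \<pi> $ x) \<in> alloc A t"
proof -
  define k where "k = t / set_prob \<pi> A"
  have k: "0 \<le> k" "k \<le> 1" "k * set_prob \<pi> A = t"
    using assms set_prob_pos[OF assms(3)] by (auto simp: k_def)
  then have "(\<Sum>x\<in>A. k * \<pi> $ x) = t"
    by (simp add: sum_distrib_left[symmetric] set_prob_def)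
  then show ?thesis
    unfolding k_def[symmetric] using k by (simp add: alloc_def mult_left_le_one_le)
qed

lemma alloc_nonempty: "0 \<le> t \<Longrightarrow> t \<le> set_prob \<pi> A \<Longrightarrow> A \<noteq> {} \<Longrightarrow> alloc A t \<noteq> {}"
  using proportional_alloc by blast

lemma Psi_ge:
  assumes "0 \<le> t" "t \<le> set_prob \<pi> A" "A \<noteq> {}"
    and "\<And>\<beta>. \<beta> \<in> alloc A t \<Longrightarrow> r \<le> alloc_flow A \<beta>"
  shows "r \<le> Psi P \<pi> I t A"
  unfolding Psi_alloc using alloc_nonempty[OF assms(1-3)] assms(4) by (intro cINF_greatest) auto

lemma Psi_big_le:
  assumes "0 \<le> t" "t \<le> set_prob \<pi> A" "A \<noteq> {}"
    and "\<And>\<beta>. \<beta> \<in> alloc A t \<Longrightarrow> alloc_flow A \<beta> \<le> r"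
  shows "Psi_big P \<pi> I t A \<le> r"
  unfolding Psi_big_alloc using alloc_nonempty[OF assms(1-3)] assms(4) by (intro cSUP_least) auto

lemma alloc_flow_proportional:
  "alloc_flow A (\<lambda>x. t / set_prob \<pi> A * \<pi> $ x) = t / set_prob \<pi> A * cut_flow A"
  by (simp add: alloc_flow_def cut_flow_def sum_distrib_left mult.assoc)

text \<open>Scaling an allocation down does not increase its flow. Monotonicity provides
  integrability.\<close>

lemma Psi_mono:
  assumes "A \<noteq> {}"
  shows "mono_on {0..set_prob \<pi> A} (\<lambda>t. Psi P \<pi> I t A)"
proof (rule mono_onI)
  fix s t assume st: "s \<in> {0..set_prob \<pi> A}" "t \<in> {0..set_prob \<pi> A}" "s \<le> t"
  show "Psi P \<pi> I s A \<le> Psi P \<pi> I t A"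
  proof (rule Psi_ge)
    fix \<beta> assume \<beta>: "\<beta> \<in> alloc A t"
    define k where "k = (if t = 0 then 1 else s / t)"
    have k: "0 \<le> k" "k \<le> 1" "k * t = s" using st by (auto simp: k_def)
    have "k * \<beta> x \<le> \<pi> $ x" if "x \<in> A" for x
      using \<beta> that k mult_left_le_one_le[of "\<beta> x" k] by (force simp: alloc_def)
    then have "(\<lambda>x. k * \<beta> x) \<in> alloc A s"
      using \<beta> k by (simp add: alloc_def sum_distrib_left[symmetric])
    then have "Psi P \<pi> I s A \<le> alloc_flow A (\<lambda>x. k * \<beta> x)" by (rule Psi_le)
    also have "\<dots> = k * alloc_flow A \<beta>" by (simp add: alloc_flow_def sum_distrib_left mult.assoc)
    also have "\<dots> \<le> alloc_flow A \<beta>"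
      using k alloc_flow_bounds(1)[OF \<beta>] by (simp add: mult_left_le_one_le)
    finally show "Psi P \<pi> I s A \<le> alloc_flow A \<beta>" .
  qed (use st assms in auto)
qed

lemma Psi_big_mono:
  assumes "A \<noteq> {}"
  shows "mono_on {0..set_prob \<pi> A} (\<lambda>t. Psi_big P \<pi> I t A)"
proof (rule mono_onI)
  fix s t assume st: "s \<in> {0..set_prob \<pi> A}" "t \<in> {0..set_prob \<pi> A}" "s \<le> t"
  show "Psi_big P \<pi> I s A \<le> Psi_big P \<pi> I t A"
  proof (rule Psi_big_le)
    fix \<beta> assume \<beta>: "\<beta> \<in> alloc A s"
    define a where "a = set_prob \<pi> A"
    \<comment> \<open>The remaining capacity is filled proportionally. If \<open>s = a\<close> then
      also \<open>t = a\<close>, and nothing is added.\<close>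
    define k where "k = (if s = a then 0 else (t - s) / (a - s))"
    have k: "0 \<le> k" "k \<le> 1" "k * (a - s) = t - s"
      using st by (auto simp: k_def a_def divide_le_eq)
    define \<gamma> where "\<gamma> x = \<beta> x + k * (\<pi> $ x - \<beta> x)" for x
    have b: "0 \<le> \<beta> x" "\<beta> x \<le> \<pi> $ x" if "x \<in> A" for x
      using \<beta> that by (auto simp: alloc_def)
    have \<gamma>: "\<beta> x \<le> \<gamma> x" "\<gamma> x \<le> \<pi> $ x" if "x \<in> A" for x
      using b[OF that] k mult_left_le_one_le[of "\<pi> $ x - \<beta> x" k] by (auto simp: \<gamma>_def)
    have "sum \<gamma> A = s + k * (a - s)"
      using \<beta> by (simp add: \<gamma>_def sum.distrib sum_distrib_left[symmetric] sum_subtractf alloc_def a_def set_prob_def)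
    then have "\<gamma> \<in> alloc A t"
      using \<gamma> b k by (auto simp: alloc_def intro: order_trans)
    then have "alloc_flow A \<gamma> \<le> Psi_big P \<pi> I t A" by (rule Psi_big_ge)
    moreover have "alloc_flow A \<beta> \<le> alloc_flow A \<gamma>"
      unfolding alloc_flow_def using \<gamma> by (intro sum_mono mult_right_mono) auto
    ultimately show "alloc_flow A \<beta> \<le> Psi_big P \<pi> I t A" by simp
  qed (use st assms in auto)
qed

text \<open>Each pair of distinct states is charged to the one of lower rank, where the minimum is
  attained. So \<open>y\<close> collects twice the mass ranked after it plus its own mass.\<close>

lemma min_flow_ranked:
  assumes r: "inj_on r A" "\<And>x y. x \<in> A \<Longrightarrow> y \<in> A \<Longrightarrow> r x < r y \<Longrightarrow> escape A x \<le> escape A y"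
  shows "min_flow A = (\<Sum>y\<in>A. escape A y * \<pi> $ y * (2 * (set_prob \<pi> A - rank_prefix r (($) \<pi>) A y) - \<pi> $ y))"
proof -
  define e where "e = escape A"
  define c where "c y z = (if r y < r z then \<pi> $ y * \<pi> $ z * e y else 0)" for y z
  have "min_flow A = (\<Sum>y\<in>A. \<Sum>z\<in>A. c y z + c z y + (if y = z then \<pi> $ y * \<pi> $ y * e y else 0))"
    unfolding min_flow_def
  proof (intro sum.cong refl)
    fix y z assume yz: "y \<in> A" "z \<in> A"
    consider "r y < r z" | "r z < r y" | "y = z"
      using inj_onD[OF r(1) _ yz] by (metis linorder_neqE_nat)
    then show "\<pi> $ y * \<pi> $ z * min (escape A y) (escape A z)
        = c y z + c z y + (if y = z then \<pi> $ y * \<pi> $ y * e y else 0)"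
      using r(2) yz by cases (auto simp: c_def e_def min_def intro!: antisym)
  qed
  also have "\<dots> = (\<Sum>y\<in>A. \<Sum>z\<in>A. c y z) + (\<Sum>y\<in>A. \<Sum>z\<in>A. c z y) + (\<Sum>y\<in>A. \<pi> $ y * \<pi> $ y * e y)"
    by (simp add: sum.distrib)
  also have "(\<Sum>y\<in>A. \<Sum>z\<in>A. c z y) = (\<Sum>y\<in>A. \<Sum>z\<in>A. c y z)" by (rule sum.swap)
  also have "(\<Sum>y\<in>A. \<Sum>z\<in>A. c y z)
      = (\<Sum>y\<in>A. e y * \<pi> $ y * (set_prob \<pi> A - rank_prefix r (($) \<pi>) A y - \<pi> $ y))"
  proof (rule sum.cong)
    fix y assume y: "y \<in> A"
    have "\<pi> $ z = (if r y < r z then \<pi> $ z else 0) + (if r z < r y then \<pi> $ z else 0) + (if z = y then \<pi> $ z else 0)"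
      if "z \<in> A" for z
      using inj_onD[OF r(1) _ that y] by (auto simp: not_less)
    then have "set_prob \<pi> A = (\<Sum>z\<in>A. (if r y < r z then \<pi> $ z else 0) + (if r z < r y then \<pi> $ z else 0) + (if z = y then \<pi> $ z else 0))"
      unfolding set_prob_def by (intro sum.cong) auto
    also have "\<dots> = (\<Sum>z\<in>A. if r y < r z then \<pi> $ z else 0) + rank_prefix r (($) \<pi>) A y + \<pi> $ y"
      using y by (simp add: sum.distrib rank_prefix_def sum.inter_filter)
    finally have *: "(\<Sum>z\<in>A. if r y < r z then \<pi> $ z else 0) = set_prob \<pi> A - rank_prefix r (($) \<pi>) A y - \<pi> $ y"
      by simp
    have "(\<Sum>z\<in>A. c y z) = (\<Sum>z\<in>A. e y * \<pi> $ y * (if r y < r z then \<pi> $ z else 0))"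
      by (intro sum.cong) (auto simp: c_def)
    then show "(\<Sum>z\<in>A. c y z) = e y * \<pi> $ y * (set_prob \<pi> A - rank_prefix r (($) \<pi>) A y - \<pi> $ y)"
      unfolding sum_distrib_left[symmetric] * .
  qed simp
  finally show ?thesis
    unfolding sum.distrib[symmetric] e_def
    by (rule trans) (intro sum.cong refl, simp add: algebra_simps)
qed

text \<open>
  The allocation fills the states of \<open>A\<close> in increasing order of their escape probability; this is
  the minimizer in \<open>Psi\<close>.
\<close>

lemma integral_Psi_le_min_flow:
  assumes A: "A \<noteq> {}"
  shows "integral {0..set_prob \<pi> A} (\<lambda>t. Psi P \<pi> I t A) \<le> min_flow A / 2"
proof -
  define a where "a = set_prob \<pi> A"
  obtain r :: "'k \<Rightarrow> nat" where r: "inj_on r A"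
      "\<And>x y. x \<in> A \<Longrightarrow> y \<in> A \<Longrightarrow> r x < r y \<Longrightarrow> escape A x \<le> escape A y"
    using ex_monotone_ranking[of A "escape A"] by auto
  define s where "s = rank_prefix r (($) \<pi>) A"
  \<comment> \<open>The part below \<open>t\<close> of the tile of length \<open>\<pi> $ y\<close>
    that starts at \<open>s y\<close>.\<close>
  define \<beta> where "\<beta> t y = min t (s y + \<pi> $ y) - min t (s y)" for t y
  have s_nonneg: "0 \<le> s y" for y by (simp add: s_def rank_prefix_def sum_nonneg)
  have s_le: "s y + \<pi> $ y \<le> a" if "y \<in> A" for y
  proof -
    have "s y + \<pi> $ y = sum (($) \<pi>) (insert y {z \<in> A. r z < r y})"
      by (simp add: s_def rank_prefix_def add.commute)
    also have "\<dots> \<le> a" unfolding a_def set_prob_def using that by (intro sum_mono2) auto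
    finally show ?thesis .
  qed
  have alloc: "\<beta> t \<in> alloc A t" if "t \<in> {0..a}" for t
  proof -
    have "sum (\<beta> t) A = t"
      using sum_rank_prefix_telescope[OF _ r(1), of "min t" "($) \<pi>"] that
      by (simp add: \<beta>_def[abs_def] s_def a_def set_prob_def)
    moreover have "0 \<le> \<beta> t y \<and> \<beta> t y \<le> \<pi> $ y" for y
      using pi_pos[of y] by (auto simp: \<beta>_def min_def)
    ultimately show ?thesis by (simp add: alloc_def)
  qed
  have int: "((\<lambda>t. alloc_flow A (\<beta> t)) has_integral
      (\<Sum>y\<in>A. ((a * (s y + \<pi> $ y) - (s y + \<pi> $ y)\<^sup>2 / 2) - (a * s y - (s y)\<^sup>2 / 2)) * escape A y)) {0..a}"
    unfolding alloc_flow_def \<beta>_def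
  proof (rule has_integral_sum)
    fix y assume "y \<in> A"
    then have "0 \<le> s y" "s y \<le> a" "0 \<le> s y + \<pi> $ y" "s y + \<pi> $ y \<le> a"
      using s_le[of y] s_nonneg[of y] pi_nonneg[of y] by linarith+
    then show "((\<lambda>t. (min t (s y + \<pi> $ y) - min t (s y)) * escape A y) has_integral
        ((a * (s y + \<pi> $ y) - (s y + \<pi> $ y)\<^sup>2 / 2) - (a * s y - (s y)\<^sup>2 / 2)) * escape A y) {0..a}"
      by (intro has_integral_mult_left has_integral_diff has_integral_min)
  qed simp
  have mf: "min_flow A = (\<Sum>y\<in>A. escape A y * \<pi> $ y * (2 * (a - s y) - \<pi> $ y))"
    unfolding a_def s_def using r by (rule min_flow_ranked)
  have "integral {0..a} (\<lambda>t. Psi P \<pi> I t A) \<le> integral {0..a} (\<lambda>t. alloc_flow A (\<beta> t))"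
  proof (rule integral_le)
    show "(\<lambda>t. Psi P \<pi> I t A) integrable_on {0..a}"
      unfolding a_def using Psi_mono[OF A] by (rule integrable_on_mono_on)
  qed (use int alloc Psi_le in \<open>auto simp: has_integral_iff\<close>)
  also have "\<dots> = min_flow A / 2"
    unfolding integral_unique[OF int] mf a_def[symmetric] s_def[symmetric] sum_divide_distrib
    by (intro sum.cong refl) (simp add: power2_eq_square field_simps)
  finally show ?thesis by (simp add: a_def)
qed

section \<open>Bounds for a single set\<close>

lemma psi_plus_set_eq:
  "psi_plus_set P \<pi> I A = integral {0..set_prob \<pi> A} (\<lambda>t. Psi P \<pi> I t A) / (set_prob \<pi> A)\<^sup>2"
  by (simp add: psi_plus_set_def)

lemma psi_plus_set_le_min_flow:
  assumes "A \<noteq> {}"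
  shows "psi_plus_set P \<pi> I A / 4 \<le> min_flow A / (8 * (set_prob \<pi> A)\<^sup>2)"
  using integral_Psi_le_min_flow[OF assms] set_prob_pos[OF assms]
  by (simp add: psi_plus_set_eq field_simps)

text \<open>Each minimum in \<open>min_flow\<close> is at most \<open>1 / 2\<close>. The resulting
  constant yields the hypothesis \<open>c \<le> 1 / 16\<close> of
  \<open>exp_decay_floor_bound\<close>.\<close>

lemma psi_plus_set_le:
  assumes A: "A \<noteq> {}" and e: "\<And>x. x \<in> A \<Longrightarrow> escape A x \<le> 1 / 2"
  shows "psi_plus_set P \<pi> I A \<le> 1 / 4"
proof -
  have "min_flow A \<le> (\<Sum>x\<in>A. \<Sum>y\<in>A. \<pi> $ x * \<pi> $ y * (1 / 2))"
    unfolding min_flow_def by (intro sum_mono mult_left_mono min.coboundedI1 e) auto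
  also have "\<dots> = (set_prob \<pi> A)\<^sup>2 / 2"
    by (simp add: set_prob_def power2_eq_square sum_product sum_divide_distrib)
  finally have "min_flow A / (8 * (set_prob \<pi> A)\<^sup>2) \<le> 1 / 16"
    using set_prob_pos[OF A] by (simp add: field_simps)
  then show ?thesis using psi_plus_set_le_min_flow[OF A] by simp
qed

text \<open>On the last stretch of length \<open>q / 2\<close>, an allocation misses at most half of
  the cut flow, so \<open>Psi\<close> is at least \<open>q / 2\<close> there.\<close>

lemma psi_plus_set_pos:
  assumes A: "A \<noteq> {}" and "0 < cut_flow A"
  shows "0 < psi_plus_set P \<pi> I A"
proof -
  define a q where "a = set_prob \<pi> A" and "q = cut_flow A"
  have "q \<le> a"
    unfolding q_def a_def cut_flow_def set_prob_def by (intro sum_mono mult_left_le escape_le_1) auto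
  have q: "0 < q" using assms by (simp add: q_def)
  have int: "(\<lambda>t. Psi P \<pi> I t A) integrable_on {0..a}"
    unfolding a_def using Psi_mono[OF A] by (rule integrable_on_mono_on)
  have sub: "{a - q / 2..a} \<subseteq> {0..a}" using q \<open>q \<le> a\<close> by auto
  have int': "(\<lambda>t. Psi P \<pi> I t A) integrable_on {a - q / 2..a}"
    using integrable_on_subinterval[OF int sub] .
  have "q / 2 * (q / 2) = integral {a - q / 2..a} (\<lambda>t. q / 2)" using q by simp
  also have "\<dots> \<le> integral {a - q / 2..a} (\<lambda>t. Psi P \<pi> I t A)"
  proof (rule integral_le)
    fix t assume t: "t \<in> {a - q / 2..a}"
    show "q / 2 \<le> Psi P \<pi> I t A"
    proof (rule Psi_ge)
      fix \<beta> assume "\<beta> \<in> alloc A t"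
      then show "q / 2 \<le> alloc_flow A \<beta>"
        using alloc_flow_bounds(3)[of \<beta> A t] t by (simp add: a_def[symmetric] q_def[symmetric])
    qed (use t sub A in \<open>auto simp: a_def\<close>)
  qed (use int' in auto)
  also have "\<dots> \<le> integral {0..a} (\<lambda>t. Psi P \<pi> I t A)"
  proof (rule integral_subset_le[OF sub int' int], rule ballI)
    fix t assume "t \<in> {0..a}"
    then show "0 \<le> Psi P \<pi> I t A"
      by (intro Psi_ge alloc_flow_bounds(1)) (auto simp: a_def A)
  qed
  finally have "0 < integral {0..a} (\<lambda>t. Psi P \<pi> I t A)"
    using q by (smt (verit) half_gt_zero mult_pos_pos)
  then show ?thesis using set_prob_pos[OF A] by (simp add: psi_plus_set_eq a_def)
qed

lemma psi_big_set_ge: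
  assumes A: "A \<noteq> {}"
  shows "cut_flow A / (2 * set_prob \<pi> A) \<le> psi_big_set P \<pi> I A"
proof -
  define a where "a = set_prob \<pi> A"
  have a: "0 < a" using set_prob_pos[OF A] by (simp add: a_def)
  have int: "(\<lambda>t. Psi_big P \<pi> I t A) integrable_on {0..a}"
    unfolding a_def using Psi_big_mono[OF A] by (rule integrable_on_mono_on)
  have id: "((\<lambda>t. t * (cut_flow A / a)) has_integral (a\<^sup>2 / 2 * (cut_flow A / a))) {0..a}"
    using ident_has_integral[of 0 a] a by (intro has_integral_mult_left) simp
  have "a\<^sup>2 / 2 * (cut_flow A / a) = integral {0..a} (\<lambda>t. t * (cut_flow A / a))"
    using id by (rule integral_unique[symmetric])
  also have "\<dots> \<le> integral {0..a} (\<lambda>t. Psi_big P \<pi> I t A)"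
  proof (rule integral_le[OF _ int])
    show "(\<lambda>t. t * (cut_flow A / a)) integrable_on {0..a}" using id by (rule has_integral_integrable)
    fix t assume "t \<in> {0..a}"
    then show "t * (cut_flow A / a) \<le> Psi_big P \<pi> I t A"
      using Psi_big_ge[OF proportional_alloc[of t A], unfolded alloc_flow_proportional] A
      by (simp add: a_def)
  qed
  finally have "a\<^sup>2 / 2 * (cut_flow A / a) / a\<^sup>2 \<le> integral {0..a} (\<lambda>t. Psi_big P \<pi> I t A) / a\<^sup>2"
    by (rule divide_right_mono) simp
  moreover have "a\<^sup>2 / 2 * (cut_flow A / a) / a\<^sup>2 = cut_flow A / (2 * a)" using a by simp
  ultimately show ?thesis by (simp add: psi_big_set_def a_def)
qed

end

subsection \<open>Gap and mixing time\<close>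

locale lazy_continuized_chain = lazy_reversible_chain P \<pi> + continuized_chain P \<pi> I
  for P :: "real ^ 'k::finite ^ 'k" and \<pi> :: "real ^ 'k" and I :: "'k \<Rightarrow> real set"
begin

definition small_sets :: "'k set set" where
  "small_sets = {A. A \<noteq> {} \<and> set_prob \<pi> A \<le> 1 / 2}"

lemma small_sets_nonempty: "small_sets \<noteq> {}"
proof -
  obtain u where "\<pi> $ u \<le> 1 / 2" using ex_small_state ..
  then have "{u} \<in> small_sets" by (simp add: small_sets_def set_prob_def)
  then show ?thesis by blast
qed

text \<open>The infima run over a nonempty finite family and are attained, so strict positivity
  passes from single sets to \<open>psi_plus\<close>.\<close>

lemma psi_eq_Min:
  "psi_plus P \<pi> I (1 / 2) = Min (psi_plus_set P \<pi> I ` small_sets)"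
  "psi_big P \<pi> I (1 / 2) = Min (psi_big_set P \<pi> I ` small_sets)"
  unfolding psi_plus_def psi_big_def small_sets_def[symmetric]
  using small_sets_nonempty by (auto intro!: cInf_eq_Min)

lemma cut_flow_pos:
  assumes "A \<in> small_sets"
  shows "0 < cut_flow A"
proof (rule ccontr)
  have "0 \<le> cut_flow A" unfolding cut_flow_def by (intro sum_nonneg mult_nonneg_nonneg) auto
  moreover assume "\<not> 0 < cut_flow A"
  ultimately have "cut_flow A = 0" by simp
  then have "\<pi> $ x * escape A x = 0" if "x \<in> A" for x
    unfolding cut_flow_def using that by (subst (asm) sum_nonneg_eq_0_iff) auto
  then have "escape A x = 0" if "x \<in> A" for x
    using that pi_pos[of x] by (metis less_irrefl mult_eq_0_iff)
  then have "P $ x $ y = 0" if "x \<in> A" "y \<notin> A" for x y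
    using that unfolding escape_def by (subst (asm) sum_nonneg_eq_0_iff) (auto simp: P_nonneg)
  then have "A = UNIV" using assms by (intro closed_imp_UNIV) (auto simp: small_sets_def)
  then show False using assms pi_sum by (simp add: small_sets_def set_prob_def)
qed

lemma escape_le_half:
  assumes "x \<in> A"
  shows "escape A x \<le> 1 / 2"
proof -
  have "P $ x $ x \<le> (\<Sum>y\<in>A. P $ x $ y)"
    using assms by (intro member_le_sum) (auto simp: P_nonneg)
  then show ?thesis using lazy[of x] sum_P_in[of x A] by simp
qed

lemma psi_plus_pos: "0 < psi_plus P \<pi> I (1 / 2)"
  unfolding psi_eq_Min using small_sets_nonempty psi_plus_set_pos cut_flow_pos
  by (subst Min_gr_iff) (auto simp: small_sets_def)

lemma psi_plus_le: "A \<in> small_sets \<Longrightarrow> psi_plus P \<pi> I (1 / 2) \<le> psi_plus_set P \<pi> I A"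
  unfolding psi_eq_Min by simp

lemma psi_plus_le_quarter: "psi_plus P \<pi> I (1 / 2) \<le> 1 / 4"
proof -
  obtain A where A: "A \<in> small_sets" using small_sets_nonempty by blast
  have "psi_plus_set P \<pi> I A \<le> 1 / 4"
    using A escape_le_half by (intro psi_plus_set_le) (auto simp: small_sets_def)
  then show ?thesis using psi_plus_le[OF A] by simp
qed

lemma second_eigenvalue_le_psi_plus:
  assumes "f \<noteq> 0" "mean f = 0" "P *v f = \<mu> *\<^sub>R f"
  shows "\<mu> \<le> 1 - psi_plus P \<pi> I (1 / 2) / 4"
proof (rule second_eigenvalue_le[OF assms])
  fix A :: "'k set" assume "A \<noteq> {}" "set_prob \<pi> A \<le> 1 / 2"
  then show "psi_plus P \<pi> I (1 / 2) / 4 \<le> min_flow A / (8 * (set_prob \<pi> A)\<^sup>2)"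
    using psi_plus_set_le_min_flow[of A] psi_plus_le[of A] by (simp add: small_sets_def)
qed

text \<open>For sets of mass at most \<open>1 / 2\<close> the factor
  \<open>1 - set_prob \<pi> A\<close> in \<open>gap_le_cut_flow\<close> is at least
  \<open>1 / 2\<close>; \<open>psi_big_set_ge\<close> contributes the other factor 2.\<close>

lemma gap_le_psi_big:
  assumes mu: "\<And>h. mean h = 0 \<Longrightarrow> ip h (P *v h) \<le> \<mu> * ip h h" and "\<mu> \<le> 1"
  shows "1 - \<mu> \<le> 4 * psi_big P \<pi> I (1 / 2)"
proof -
  have "(1 - \<mu>) / 4 \<le> psi_big_set P \<pi> I A" if A: "A \<in> small_sets" for A
  proof -
    define a where "a = set_prob \<pi> A"
    have a: "0 < a" "a \<le> 1 / 2" using A set_prob_pos[of A] by (auto simp: a_def small_sets_def)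
    have "(1 - \<mu>) * (a * (1 / 2)) \<le> (1 - \<mu>) * (a * (1 - a))"
      using a assms(2) by (intro mult_left_mono) auto
    also have "\<dots> \<le> cut_flow A" unfolding a_def by (rule gap_le_cut_flow[OF mu])
    finally have "(1 - \<mu>) / 4 \<le> cut_flow A / (2 * a)" using a by (simp add: field_simps)
    then show ?thesis using psi_big_set_ge[of A] A by (simp add: a_def small_sets_def)
  qed
  then have "(1 - \<mu>) / 4 \<le> psi_big P \<pi> I (1 / 2)"
    unfolding psi_eq_Min using small_sets_nonempty by (subst Min_ge_iff) auto
  then show ?thesis by simp
qed

lemma mixing_bounds:
  "(\<forall>\<epsilon>::real. 0 < \<epsilon> \<and> \<epsilon> \<le> 1 / 2 \<longrightarrow>
      (1 - 4 * psi_big P \<pi> I (1 / 2)) / (8 * psi_big P \<pi> I (1 / 2)) * ln (1 / (2 * \<epsilon>))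
        \<le> real (mixing_time P \<pi> \<epsilon>) \<and>
      real (mixing_time P \<pi> \<epsilon>)
        \<le> 2 / psi_plus P \<pi> I (1 / 2) *
           (ln (1 / Min (range (\<lambda>v. \<pi> $ v))) + 2 * ln (1 / (2 * \<epsilon>)))) \<and>
   4 * psi_big P \<pi> I (1 / 2) \<ge> spectral_gap P \<and>
   spectral_gap P \<ge> 1 / 4 * psi_plus P \<pi> I (1 / 2)"
proof -
  obtain \<mu> f where f: "f \<noteq> 0" "mean f = 0" "P *v f = \<mu> *\<^sub>R f"
    and mu: "\<And>h. mean h = 0 \<Longrightarrow> ip h (P *v h) \<le> \<mu> * ip h h"
    using ex_top_eigenvector by metis
  define \<psi> where "\<psi> = psi_plus P \<pi> I (1 / 2)"
  define p where "p = Min (range (\<lambda>v. \<pi> $ v))"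
  have \<psi>: "0 < \<psi>" "\<psi> \<le> 1 / 4" "\<mu> \<le> 1 - \<psi> / 4"
    using psi_plus_pos psi_plus_le_quarter second_eigenvalue_le_psi_plus[OF f] by (auto simp: \<psi>_def)
  have "0 \<le> \<mu> * ip f f" using ip_P_nonneg[of f] f by (simp add: ip_simps)
  then have "0 \<le> \<mu>" using ip_pos[OF f(1)] by (simp add: zero_le_mult_iff)
  have "\<mu> < 1" by (rule second_eigenvalue_lt_1[OF f])
  have gap: "spectral_gap P = 1 - \<mu>" by (rule spectral_gap_eq[OF f mu])
  have big: "1 - \<mu> \<le> 4 * psi_big P \<pi> I (1 / 2)"
    using mu \<open>\<mu> < 1\<close> by (intro gap_le_psi_big) auto
  have p_le: "p \<le> \<pi> $ i" for i by (simp add: p_def)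
  have "p \<in> range (\<lambda>v. \<pi> $ v)" unfolding p_def by (rule Min_in) auto
  then have p: "0 < p" using pi_pos by auto
  have "p \<le> 1 / 2" using ex_small_state p_le by (meson order_trans)
  have time: "(1 - 4 * psi_big P \<pi> I (1 / 2)) / (8 * psi_big P \<pi> I (1 / 2)) * ln (1 / (2 * \<epsilon>))
        \<le> real (mixing_time P \<pi> \<epsilon>) \<and>
      real (mixing_time P \<pi> \<epsilon>) \<le> 2 / \<psi> * (ln (1 / p) + 2 * ln (1 / (2 * \<epsilon>)))"
    if \<epsilon>: "0 < \<epsilon>" "\<epsilon> \<le> 1 / 2" for \<epsilon>
  proof -
    define X where "X = 2 / \<psi> * (ln (1 / p) + 2 * ln (1 / (2 * \<epsilon>)))"
    have "0 \<le> X" unfolding X_def using \<psi> p \<open>p \<le> 1 / 2\<close> \<epsilon>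
      by (intro mult_nonneg_nonneg add_nonneg_nonneg) auto
    have tv: "tv_dist (q v* mat_power P (nat \<lfloor>X\<rfloor>)) \<pi> \<le> \<epsilon>" if "prob_vec q" for q
    proof -
      have "tv_dist (q v* mat_power P (nat \<lfloor>X\<rfloor>)) \<pi> \<le> 1 / 2 * (\<mu> ^ nat \<lfloor>X\<rfloor> * sqrt (1 / p - 1))"
        by (rule tv_dist_mat_power_le[OF mu \<open>0 \<le> \<mu>\<close> that p p_le])
      also have "\<dots> \<le> \<epsilon>"
      proof (rule exp_decay_floor_bound)
        show "\<psi> / 4 * X = ln (1 / p) / 2 + ln (1 / (2 * \<epsilon>))"
          using \<psi>(1) by (simp add: X_def field_simps)
      qed (use \<psi> p \<open>p \<le> 1 / 2\<close> \<open>0 \<le> \<mu>\<close> \<epsilon> in auto)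
      finally show ?thesis .
    qed
    then have "mixing_time P \<pi> \<epsilon> \<le> nat \<lfloor>X\<rfloor>" by (rule mixing_time_le)
    then have "real (mixing_time P \<pi> \<epsilon>) \<le> X" using \<open>0 \<le> X\<close> by linarith
    moreover have "\<mu> ^ mixing_time P \<pi> \<epsilon> \<le> 2 * \<epsilon>"
      using tv by (rule mixing_time_ge[OF f \<open>0 \<le> \<mu>\<close>])
    then have "(1 - 4 * psi_big P \<pi> I (1 / 2)) / (8 * psi_big P \<pi> I (1 / 2)) * ln (1 / (2 * \<epsilon>))
        \<le> real (mixing_time P \<pi> \<epsilon>)"
      by (rule relaxation_lower_bound[OF \<open>0 \<le> \<mu>\<close> \<open>\<mu> < 1\<close> big \<epsilon>])
    ultimately show ?thesis by (simp add: X_def)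
  qed
  show ?thesis
    using time big \<psi>(3) unfolding gap \<psi>_def p_def by auto
qed

end

theorem theorem3p3:
  fixes P :: "real ^ 'k::finite ^ 'k"
    and \<pi> :: "real ^ 'k"
    and I :: "'k \<Rightarrow> real set"
  assumes "CARD('k) \<ge> 2"
    and "transition_matrix P"
    and "lazy_chain P"
    and "aperiodic_chain P"
    and "ergodic_chain P"
    and "stationary_dist P \<pi>"
    and "reversible_chain P \<pi>"
    and "interval_partition \<pi> I"
  shows "(\<forall>\<epsilon>::real. 0 < \<epsilon> \<and> \<epsilon> \<le> 1 / 2 \<longrightarrow>
            (1 - 4 * psi_big P \<pi> I (1 / 2)) / (8 * psi_big P \<pi> I (1 / 2)) * ln (1 / (2 * \<epsilon>))
              \<le> real (mixing_time P \<pi> \<epsilon>) \<and>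
            real (mixing_time P \<pi> \<epsilon>)
              \<le> 2 / psi_plus P \<pi> I (1 / 2) *
                 (ln (1 / Min (range (\<lambda>v. \<pi> $ v))) + 2 * ln (1 / (2 * \<epsilon>)))) \<and>
         4 * psi_big P \<pi> I (1 / 2) \<ge> spectral_gap P \<and>
         spectral_gap P \<ge> 1 / 4 * psi_plus P \<pi> I (1 / 2)"
proof -
  have irreducible: "irreducible_chain P" using assms(5) by (simp add: ergodic_chain_def)
  have rev: "\<pi> $ i * P $ i $ j = \<pi> $ j * P $ j $ i" for i j
    using assms(7) by (simp add: reversible_chain_def)
  have \<pi>: "0 \<le> \<pi> $ i" "(\<Sum>i\<in>UNIV. \<pi> $ i) = 1" for i
    using assms(6) by (auto simp: stationary_dist_def prob_vec_def)
  \<comment> \<open>By reversibility the chain cannot move from the support of \<open>\<pi>\<close>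
    to a state of mass zero, so the support is closed.\<close>
  have "{i. \<pi> $ i \<noteq> 0} = UNIV"
  proof (rule irreducible_closed_imp_UNIV[OF irreducible])
    show "{i. \<pi> $ i \<noteq> 0} \<noteq> {}"
    proof
      assume "{i. \<pi> $ i \<noteq> 0} = {}"
      then have "\<pi> $ i = 0" for i by blast
      then show False using \<pi>(2) by simp
    qed
    show "P $ i $ j = 0" if "i \<in> {i. \<pi> $ i \<noteq> 0}" "j \<notin> {i. \<pi> $ i \<noteq> 0}" for i j
      using that rev[of i j] by simp
  qed
  then have pos: "0 < \<pi> $ i" for i using \<pi>(1)[of i] by (metis (mono_tags) UNIV_I less_eq_real_def mem_Collect_eq)
  interpret lazy_continuized_chain P \<pi> I
  proof
    show "0 \<le> P $ i $ j" "(\<Sum>j\<in>UNIV. P $ i $ j) = 1" for i j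
      using assms(2) by (auto simp: transition_matrix_def prob_vec_def)
    show "1 / 2 \<le> P $ i $ i" for i using assms(3) by (simp add: lazy_chain_def)
    show "S = UNIV" if "S \<noteq> {}" "\<And>i j. i \<in> S \<Longrightarrow> j \<notin> S \<Longrightarrow> P $ i $ j = 0" for S
      using irreducible that by (rule irreducible_closed_imp_UNIV)
  qed (use pos \<pi> rev assms in auto)
  show ?thesis by (rule mixing_bounds)
qed

end
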